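(* Suppose that $(M,g)$ is a Riemannian spin manifold carrying a pair $\psi_1,\psi_2$ of Killing spinors (not necessarily linearly independent) for the same Killing number $\lambda\in\{\frac12,-\frac12\}$, and suppose furthermore that $\ell:=\|\xi_{\psi_1,\psi_2}\|$ is locally constant and non-zero. Then the tensors $$\xi:=\frac1\ell\,\xi_{\psi_1,\psi_2},\qquad \eta:=\frac1\ell\,\eta_{\psi_1,\psi_2},\qquad \varphi:=\frac1\ell\,\varphi_{\psi_1,\psi_2}$$ determine a Sasakian structure on $(M,g)$.
   Context: Spinor conventions: $\Sigma M$ is the complex spinor bundle, with Clifford multiplication satisfying $X\cdot Y+Y\cdot X=-2g(X,Y)$, and $\langle\cdot,\cdot\rangle$ is its usual Hermitian metric, for which Clifford multiplication by real tangent vectors is skew-Hermitian. $\nabla^g$ denotes the Levi-Civita connection and its lift to $\Sigma M$. A Killing spinor with Killing number $\lambda$ is a section $\psi$ of $\Sigma M$ with $\nabla^g_X\psi=\lambda X\cdot\psi$ for all $X\in TM$. For spinors $\psi_1,\psi_2$ define the associated $1$-form, vector field and endomorphism field by $$\eta_{\psi_1,\psi_2}(X):=\Re\langle\psi_1,X\cdot\psi_2\rangle,\quad \xi_{\psi_1,\psi_2}:=\eta_{\psi_1,\psi_2}^\sharp,\quad \varphi_{\psi_1,\psi_2}(X):=-\tfrac12\,(X\lrcorner\, d\eta_{\psi_1,\psi_2})^\sharp,\qquad X\in TM.$$ A Sasakian structure $(g,\xi,\eta,\varphi)$ on a Riemannian manifold $(M,g)$ is a unit length Killing vector field $\xi$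 such that, with $\eta=\xi^\flat$ and $\varphi=-\nabla^g\xi$, one has $(\nabla^g_X\varphi)(Y)=g(X,Y)\xi-\eta(Y)X$ for all $X,Y\in TM$. *)

theory Defs
  imports "HOL-Analysis.Analysis"
begin

section \<open>Smooth manifolds\<close>

fun Ck_on :: "nat \<Rightarrow> (real ^ 'n) set \<Rightarrow> (real ^ 'n \<Rightarrow> 'b::real_normed_vector) \<Rightarrow> bool" where
  "Ck_on 0 S f \<longleftrightarrow> continuous_on S f"
| "Ck_on (Suc k) S f \<longleftrightarrow> (\<forall>x\<in>S. f differentiable (at x)) \<and>
     (\<forall>v. Ck_on k S (\<lambda>x. frechet_derivative f (at x) v))"

text \<open>Only used for open sets.\<close>

definition Cinf_on :: "(real ^ 'n) set \<Rightarrow> (real ^ 'n \<Rightarrow> 'b::real_normed_vector) \<Rightarrow> bool" where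
  "Cinf_on S f \<longleftrightarrow> (\<forall>k. Ck_on k S f)"

type_synonym ('m, 'n) atlas = "('m set \<times> ('m \<Rightarrow> real ^ 'n)) set"

definition smooth_atlas :: "('m::topological_space, 'n::finite) atlas \<Rightarrow> bool" where
  "smooth_atlas A \<longleftrightarrow>
     (\<Union>(U, c)\<in>A. U) = UNIV \<and>
     (\<forall>(U, c)\<in>A. open U \<and> open (c ` U) \<and> homeomorphism U (c ` U) c (inv_into U c)) \<and>
     (\<forall>(U, c)\<in>A. \<forall>(V, d)\<in>A. Cinf_on (c ` (U \<inter> V)) (d \<circ> inv_into U c))"

definition smooth_fun ::
  "('m::topological_space, 'n::finite) atlas \<Rightarrow> 'm set \<Rightarrow> ('m \<Rightarrow> 'b::real_normed_vector) \<Rightarrow> bool" where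
  "smooth_fun A U f \<longleftrightarrow> open U \<and> (\<forall>(V, c)\<in>A. Cinf_on (c ` (U \<inter> V)) (f \<circ> inv_into V c))"

definition smooth_near ::
  "('m::topological_space, 'n::finite) atlas \<Rightarrow> 'm \<Rightarrow> ('m \<Rightarrow> 'b::real_normed_vector) \<Rightarrow> bool" where
  "smooth_near A p f \<longleftrightarrow> (\<exists>U. p \<in> U \<and> smooth_fun A U f)"

text \<open>A tangent vector at \<open>p\<close> is a derivation at \<open>p\<close> of the algebra of real functions that are smooth
  near \<open>p\<close>. Such a derivation only depends on germs, because the indicator function of an open
  neighbourhood of \<open>p\<close> is smooth near \<open>p\<close>. On functions not smooth near \<open>p\<close> a tangent vector
  takes the dummy value 0, so that equality of tangent vectors is equality of functions.\<close>

type_synonym 'm tvec = "('m \<Rightarrow> real) \<Rightarrow> real"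
type_synonym 'm vfield = "'m \<Rightarrow> 'm tvec"
type_synonym 'm oneform = "'m \<Rightarrow> 'm tvec \<Rightarrow> real"
type_synonym 'm endofield = "'m \<Rightarrow> 'm tvec \<Rightarrow> 'm tvec"

definition tangent_space :: "('m::topological_space, 'n::finite) atlas \<Rightarrow> 'm \<Rightarrow> 'm tvec set" where
  "tangent_space A p = {v.
     (\<forall>f h. smooth_near A p f \<longrightarrow> smooth_near A p h \<longrightarrow>
        v (\<lambda>q. f q + h q) = v f + v h \<and>
        v (\<lambda>q. f q * h q) = v f * h p + f p * v h) \<and>
     (\<forall>f r. smooth_near A p f \<longrightarrow> v (\<lambda>q. r * f q) = r * v f) \<and>
     (\<forall>f. \<not> smooth_near A p f \<longrightarrow> v f = 0)}"

definition vector_field :: "('m::topological_space, 'n::finite) atlas \<Rightarrow> 'm set \<Rightarrow> 'm vfield \<Rightarrow> bool" where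
  "vector_field A U X \<longleftrightarrow> open U \<and> (\<forall>p\<in>U. X p \<in> tangent_space A p) \<and>
     (\<forall>V (f :: 'm \<Rightarrow> real). V \<subseteq> U \<longrightarrow> smooth_fun A V f \<longrightarrow> smooth_fun A V (\<lambda>p. X p f))"

definition vector_field_near ::
  "('m::topological_space, 'n::finite) atlas \<Rightarrow> 'm \<Rightarrow> 'm vfield \<Rightarrow> bool" where
  "vector_field_near A p X \<longleftrightarrow> (\<exists>U. p \<in> U \<and> vector_field A U X)"

text \<open>The value is cut off to 0 on functions not smooth near the point, to agree with the
  normalisation in \<open>tangent_space\<close>.\<close>

definition lie_bracket ::
  "('m::topological_space, 'n::finite) atlas \<Rightarrow> 'm vfield \<Rightarrow> 'm vfield \<Rightarrow> 'm vfield" where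
  "lie_bracket A X Y = (\<lambda>p f. if smooth_near A p f
      then X p (\<lambda>q. Y q f) - Y p (\<lambda>q. X q f) else 0)"

text \<open>The exterior derivative of a 1-form is
  \<open>d\<eta>(X,Y) = X(\<eta>(Y)) - Y(\<eta>(X)) - \<eta>([X,Y])\<close> (without a factor 1/2), whose value at \<open>p\<close> only depends
  on the values of the vector fields at \<open>p\<close>.\<close>

definition ext_deriv ::
  "('m::topological_space, 'n::finite) atlas \<Rightarrow> 'm oneform \<Rightarrow> 'm \<Rightarrow> 'm tvec \<Rightarrow> 'm tvec \<Rightarrow> real" where
  "ext_deriv A \<eta> p v w = (THE r. \<forall>X Y.
     vector_field_near A p X \<longrightarrow> vector_field_near A p Y \<longrightarrow> X p = v \<longrightarrow> Y p = w \<longrightarrow>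
       r = X p (\<lambda>q. \<eta> q (Y q)) - Y p (\<lambda>q. \<eta> q (X q)) - \<eta> p (lie_bracket A X Y p))"


section \<open>Riemannian manifolds\<close>

record ('m, 'n) riem =
  atl :: "('m, 'n) atlas"
  met :: "'m \<Rightarrow> 'm tvec \<Rightarrow> 'm tvec \<Rightarrow> real"

abbreviation tspace :: "('m::topological_space, 'n::finite, 'z) riem_scheme \<Rightarrow> 'm \<Rightarrow> 'm tvec set" where
  "tspace M p \<equiv> tangent_space (atl M) p"

definition riemannian_manifold ::
  "('m::{t2_space, second_countable_topology}, 'n::finite, 'z) riem_scheme \<Rightarrow> bool" where
  "riemannian_manifold M \<longleftrightarrow> smooth_atlas (atl M) \<and>
     (\<forall>p. \<forall>u\<in>tspace M p. \<forall>v\<in>tspace M p. met M p u v = met M p v u) \<and>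
     (\<forall>p. \<forall>u\<in>tspace M p. \<forall>v\<in>tspace M p. \<forall>w\<in>tspace M p. \<forall>a b.
        met M p (\<lambda>f. a * u f + b * v f) w = a * met M p u w + b * met M p v w) \<and>
     (\<forall>p. \<forall>v\<in>tspace M p. v \<noteq> (\<lambda>f. 0) \<longrightarrow> met M p v v > 0) \<and>
     (\<forall>U X Y. vector_field (atl M) U X \<longrightarrow> vector_field (atl M) U Y \<longrightarrow>
        smooth_fun (atl M) U (\<lambda>p. met M p (X p) (Y p)))"

text \<open>A connection is written \<open>D Y p v\<close> for the derivative at \<open>p\<close> of the (locally defined) vector
  field \<open>Y\<close> in the direction \<open>v\<close>. Its values matter only for \<open>v\<close> tangent at \<open>p\<close> and \<open>Y\<close> smooth
  near \<open>p\<close>; locality in \<open>Y\<close> follows from the Leibniz rule with indicator functions of open sets.\<close>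

type_synonym 'm conn = "'m vfield \<Rightarrow> 'm endofield"

definition affine_connection ::
  "('m::topological_space, 'n::finite) atlas \<Rightarrow> 'm conn \<Rightarrow> bool" where
  "affine_connection A D \<longleftrightarrow>
     (\<forall>p Y. vector_field_near A p Y \<longrightarrow> (\<forall>v\<in>tangent_space A p. D Y p v \<in> tangent_space A p)) \<and>
     (\<forall>p Y a b. vector_field_near A p Y \<longrightarrow> (\<forall>v\<in>tangent_space A p. \<forall>w\<in>tangent_space A p.
        D Y p (\<lambda>f. a * v f + b * w f) = (\<lambda>f. a * D Y p v f + b * D Y p w f))) \<and>
     (\<forall>p Y Z. vector_field_near A p Y \<longrightarrow> vector_field_near A p Z \<longrightarrow>
        (\<forall>v\<in>tangent_space A p.
           D (\<lambda>q f. Y q f + Z q f) p v = (\<lambda>f. D Y p v f + D Z p v f))) \<and>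
     (\<forall>p Y h. vector_field_near A p Y \<longrightarrow> smooth_near A p h \<longrightarrow>
        (\<forall>v\<in>tangent_space A p.
           D (\<lambda>q f. h q * Y q f) p v = (\<lambda>f. v h * Y p f + h p * D Y p v f))) \<and>
     (\<forall>U X Y. vector_field A U X \<longrightarrow> vector_field A U Y \<longrightarrow>
        vector_field A U (\<lambda>q. D Y q (X q)))"

definition levi_civita ::
  "('m::topological_space, 'n::finite, 'z) riem_scheme \<Rightarrow> 'm conn \<Rightarrow> bool" where
  "levi_civita M D \<longleftrightarrow> affine_connection (atl M) D \<and>
     (\<forall>p Y Z. vector_field_near (atl M) p Y \<longrightarrow> vector_field_near (atl M) p Z \<longrightarrow>
        (\<forall>v\<in>tspace M p. v (\<lambda>q. met M q (Y q) (Z q))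
            = met M p (D Y p v) (Z p) + met M p (Y p) (D Z p v))) \<and>
     (\<forall>p X Y. vector_field_near (atl M) p X \<longrightarrow> vector_field_near (atl M) p Y \<longrightarrow>
        (\<lambda>f. D Y p (X p) f - D X p (Y p) f) = lie_bracket (atl M) X Y p)"

definition sharp ::
  "('m::topological_space, 'n::finite, 'z) riem_scheme \<Rightarrow> 'm \<Rightarrow> ('m tvec \<Rightarrow> real) \<Rightarrow> 'm tvec" where
  "sharp M p \<alpha> = (THE u. u \<in> tspace M p \<and> (\<forall>w\<in>tspace M p. met M p u w = \<alpha> w))"

definition orthonormal_basis ::
  "('m::topological_space, 'n::finite, 'z) riem_scheme \<Rightarrow> 'm \<Rightarrow> ('n \<Rightarrow> 'm tvec) \<Rightarrow> bool" where
  "orthonormal_basis M p e \<longleftrightarrow>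
     (\<forall>a. e a \<in> tspace M p) \<and>
     (\<forall>a b. met M p (e a) (e b) = (if a = b then 1 else 0)) \<and>
     (\<forall>v\<in>tspace M p. \<exists>x. v = (\<lambda>f. \<Sum>a\<in>UNIV. x a * e a f))"

text \<open>\<open>L\<^sub>\<xi> g = 0\<close>\<close>

definition killing_field ::
  "('m::topological_space, 'n::finite, 'z) riem_scheme \<Rightarrow> 'm vfield \<Rightarrow> bool" where
  "killing_field M \<xi> \<longleftrightarrow> vector_field (atl M) UNIV \<xi> \<and>
     (\<forall>p X Y. vector_field_near (atl M) p X \<longrightarrow> vector_field_near (atl M) p Y \<longrightarrow>
        \<xi> p (\<lambda>q. met M q (X q) (Y q))
          - met M p (lie_bracket (atl M) \<xi> X p) (Y p)
          - met M p (X p) (lie_bracket (atl M) \<xi> Y p) = 0)"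

text \<open>\<open>(\<nabla>\<^sub>v \<phi>)(Y) = \<nabla>\<^sub>v(\<phi> Y) - \<phi>(\<nabla>\<^sub>v Y)\<close>\<close>

definition cov_deriv_endo :: "'m conn \<Rightarrow> 'm endofield \<Rightarrow> 'm \<Rightarrow> 'm tvec \<Rightarrow> 'm vfield \<Rightarrow> 'm tvec" where
  "cov_deriv_endo D \<phi> p v Y = (\<lambda>f. D (\<lambda>q. \<phi> q (Y q)) p v f - \<phi> p (D Y p v) f)"

definition sasakian_structure ::
  "('m::topological_space, 'n::finite, 'z) riem_scheme \<Rightarrow> 'm conn \<Rightarrow>
     'm vfield \<Rightarrow> 'm oneform \<Rightarrow> 'm endofield \<Rightarrow> bool" where
  "sasakian_structure M D \<xi> \<eta> \<phi> \<longleftrightarrow>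
     killing_field M \<xi> \<and>
     (\<forall>p. met M p (\<xi> p) (\<xi> p) = 1) \<and>
     (\<forall>p. \<forall>v\<in>tspace M p. \<eta> p v = met M p (\<xi> p) v) \<and>
     (\<forall>p. \<forall>v\<in>tspace M p. \<phi> p v = (\<lambda>f. - D \<xi> p v f)) \<and>
     (\<forall>p Y. vector_field_near (atl M) p Y \<longrightarrow> (\<forall>v\<in>tspace M p.
        cov_deriv_endo D \<phi> p v Y = (\<lambda>f. met M p v (Y p) * \<xi> p f - \<eta> p (Y p) * v f)))"


section \<open>The spin representation and the spin group\<close>

definition herm :: "complex ^ 's \<Rightarrow> complex ^ 's \<Rightarrow> complex" where
  "herm x y = (\<Sum>i\<in>UNIV. x $ i * cnj (y $ i))"

text \<open>The dimension condition makes the complex Clifford module irreducible. For even \<open>n\<close> it is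
  unique up to unitary equivalence; for odd \<open>n\<close> there are two, both of which are allowed.\<close>

definition spin_rep :: "('n::finite \<Rightarrow> complex ^ 's::finite ^ 's) \<Rightarrow> bool" where
  "spin_rep \<gamma> \<longleftrightarrow>
     CARD('s) = 2 ^ (CARD('n) div 2) \<and>
     (\<forall>a b. \<gamma> a ** \<gamma> b + \<gamma> b ** \<gamma> a = (if a = b then mat (-2) else 0)) \<and>
     (\<forall>a x y. herm (\<gamma> a *v x) y = - herm x (\<gamma> a *v y))"

definition cliff :: "('n::finite \<Rightarrow> complex ^ 's::finite ^ 's) \<Rightarrow> real ^ 'n \<Rightarrow> complex ^ 's ^ 's" where
  "cliff \<gamma> x = (\<Sum>a\<in>UNIV. (x $ a) *\<^sub>R \<gamma> a)"

text \<open>Products of an even number of unit vectors. The complex spin representation is faithful on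
  \<open>Spin(n)\<close>, so \<open>Spin(n)\<close> is identified with its image.\<close>

definition spin_group :: "('n::finite \<Rightarrow> complex ^ 's::finite ^ 's) \<Rightarrow> (complex ^ 's ^ 's) set" where
  "spin_group \<gamma> = {s. \<exists>xs. even (length xs) \<and> (\<forall>x\<in>set xs. norm x = 1) \<and>
     s = foldr (\<lambda>x t. cliff \<gamma> x ** t) xs (mat 1)}"

text \<open>\<open>spin_covers \<gamma> s B\<close>: the double covering \<open>Spin(n) \<rightarrow> SO(n)\<close> maps \<open>s\<close> to \<open>B\<close>, that is,
  \<open>s x s\<^sup>-\<^sup>1 = B x\<close> in the Clifford algebra for all vectors \<open>x\<close>.\<close>

definition spin_covers ::
  "('n::finite \<Rightarrow> complex ^ 's::finite ^ 's) \<Rightarrow> complex ^ 's ^ 's \<Rightarrow> real ^ 'n ^ 'n \<Rightarrow> bool" where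
  "spin_covers \<gamma> s B \<longleftrightarrow> s \<in> spin_group \<gamma> \<and> (\<forall>x. s ** cliff \<gamma> x = cliff \<gamma> (B *v x) ** s)"


section \<open>Spin manifolds and the spinor bundle\<close>

text \<open>A spin structure is given by an open cover \<open>patch i\<close> with smooth orthonormal frames \<open>frm i\<close>
  whose transition functions are lifted to \<open>Spin(n)\<close>-valued functions \<open>tr i j\<close> satisfying the
  cocycle condition. These are the gluing data of the principal \<open>Spin(n)\<close>-bundle over the bundle of
  oriented orthonormal frames; the orientation is the one for which all \<open>frm i\<close> are positive, which
  is consistent because \<open>Spin(n)\<close> covers \<open>SO(n)\<close>.\<close>

record ('m, 'n, 's, 'i) spin_riem = "('m, 'n) riem" +
  gam :: "'n \<Rightarrow> complex ^ 's ^ 's"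
  patch :: "'i \<Rightarrow> 'm set"
  frm :: "'i \<Rightarrow> 'n \<Rightarrow> 'm vfield"
  tr :: "'i \<Rightarrow> 'i \<Rightarrow> 'm \<Rightarrow> complex ^ 's ^ 's"

definition spin_structure ::
  "('m::{t2_space, second_countable_topology}, 'n::finite, 's::finite, 'i) spin_riem \<Rightarrow> bool" where
  "spin_structure M \<longleftrightarrow>
     (\<forall>i. open (patch M i)) \<and> (\<Union>i. patch M i) = UNIV \<and>
     (\<forall>i a. vector_field (atl M) (patch M i) (frm M i a)) \<and>
     (\<forall>i. \<forall>p\<in>patch M i. orthonormal_basis M p (\<lambda>a. frm M i a p)) \<and>
     (\<forall>i j. smooth_fun (atl M) (patch M i \<inter> patch M j) (tr M i j)) \<and>
     (\<forall>i j. \<forall>p\<in>patch M i \<inter> patch M j. \<exists>B.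
        spin_covers (gam M) (tr M i j p) B \<and>
        (\<forall>b. frm M j b p = (\<lambda>f. \<Sum>a\<in>UNIV. B $ a $ b * frm M i a p f))) \<and>
     (\<forall>i j k. \<forall>p\<in>patch M i \<inter> patch M j \<inter> patch M k. tr M i j p ** tr M j k p = tr M i k p)"

definition riemannian_spin_manifold ::
  "('m::{t2_space, second_countable_topology}, 'n::finite, 's::finite, 'i) spin_riem \<Rightarrow> bool" where
  "riemannian_spin_manifold M \<longleftrightarrow>
     riemannian_manifold M \<and> spin_rep (gam M) \<and> spin_structure M"

text \<open>An element of the fibre at \<open>p\<close> of the associated bundle is the family \<open>\<sigma>\<close> of its components
  in the local trivialisations around \<open>p\<close> (and 0 for the other indices).\<close>

type_synonym ('s, 'i) spinor = "'i \<Rightarrow> complex ^ 's"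
type_synonym ('m, 's, 'i) spinor_field = "'m \<Rightarrow> ('s, 'i) spinor"

definition spinor_space ::
  "('m::topological_space, 'n::finite, 's::finite, 'i) spin_riem \<Rightarrow> 'm \<Rightarrow> ('s, 'i) spinor set" where
  "spinor_space M p = {\<sigma>.
     (\<forall>i j. p \<in> patch M i \<inter> patch M j \<longrightarrow> \<sigma> i = tr M i j p *v \<sigma> j) \<and>
     (\<forall>i. p \<notin> patch M i \<longrightarrow> \<sigma> i = 0)}"

definition spinor_section ::
  "('m::topological_space, 'n::finite, 's::finite, 'i) spin_riem \<Rightarrow> ('m, 's, 'i) spinor_field \<Rightarrow> bool" where
  "spinor_section M \<psi> \<longleftrightarrow> (\<forall>p. \<psi> p \<in> spinor_space M p) \<and>
     (\<forall>i. smooth_fun (atl M) (patch M i) (\<lambda>p. \<psi> p i))"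

text \<open>Independent of the choice of the trivialisation, since \<open>Spin(n)\<close> acts unitarily.\<close>

definition spinor_herm ::
  "('m::topological_space, 'n::finite, 's::finite, 'i) spin_riem \<Rightarrow> 'm \<Rightarrow>
     ('s, 'i) spinor \<Rightarrow> ('s, 'i) spinor \<Rightarrow> complex" where
  "spinor_herm M p \<sigma> \<tau> = (let i = (SOME i. p \<in> patch M i) in herm (\<sigma> i) (\<tau> i))"

definition clifford_mult ::
  "('m::topological_space, 'n::finite, 's::finite, 'i) spin_riem \<Rightarrow> 'm \<Rightarrow>
     'm tvec \<Rightarrow> ('s, 'i) spinor \<Rightarrow> ('s, 'i) spinor" where
  "clifford_mult M p v \<sigma> = (\<lambda>i. if p \<in> patch M i
     then cliff (gam M) (\<chi> a. met M p v (frm M i a p)) *v \<sigma> i else 0)"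

definition tvec_apply :: "'m tvec \<Rightarrow> ('m \<Rightarrow> complex ^ 's) \<Rightarrow> complex ^ 's" where
  "tvec_apply v F = (\<chi> k. Complex (v (\<lambda>q. Re (F q $ k))) (v (\<lambda>q. Im (F q $ k))))"

text \<open>The lift of the Levi-Civita connection \<open>D\<close> to the spinor bundle: with respect to a local
  orthonormal frame \<open>e\<close> it is \<open>\<nabla>\<^sub>v \<psi> = v(\<psi>) + 1/4 \<Sum>\<^sub>a\<^sub>b g(\<nabla>\<^sub>v e\<^sub>a, e\<^sub>b) e\<^sub>a \<cdot> e\<^sub>b \<cdot> \<psi>\<close>.\<close>

definition spin_conn ::
  "('m::topological_space, 'n::finite, 's::finite, 'i) spin_riem \<Rightarrow> 'm conn \<Rightarrow>
     ('m, 's, 'i) spinor_field \<Rightarrow> 'm \<Rightarrow> 'm tvec \<Rightarrow> ('s, 'i) spinor" where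
  "spin_conn M D \<psi> p v = (\<lambda>i. if p \<in> patch M i
     then tvec_apply v (\<lambda>q. \<psi> q i) +
       (1/4) *\<^sub>R (\<Sum>a\<in>UNIV. \<Sum>b\<in>UNIV. met M p (D (frm M i a) p v) (frm M i b p) *\<^sub>R
          (gam M a *v (gam M b *v \<psi> p i)))
     else 0)"

definition killing_spinor ::
  "('m::topological_space, 'n::finite, 's::finite, 'i) spin_riem \<Rightarrow> 'm conn \<Rightarrow>
     complex \<Rightarrow> ('m, 's, 'i) spinor_field \<Rightarrow> bool" where
  "killing_spinor M D c \<psi> \<longleftrightarrow> spinor_section M \<psi> \<and>
     (\<forall>p. \<forall>v\<in>tspace M p. spin_conn M D \<psi> p v = (\<lambda>i. c *s clifford_mult M p v (\<psi> p) i))"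


section \<open>Tensors associated with a pair of spinors\<close>

definition spinor_oneform ::
  "('m::topological_space, 'n::finite, 's::finite, 'i) spin_riem \<Rightarrow>
     ('m, 's, 'i) spinor_field \<Rightarrow> ('m, 's, 'i) spinor_field \<Rightarrow> 'm oneform" where
  "spinor_oneform M \<psi>1 \<psi>2 = (\<lambda>p v. Re (spinor_herm M p (\<psi>1 p) (clifford_mult M p v (\<psi>2 p))))"

definition spinor_vfield ::
  "('m::topological_space, 'n::finite, 's::finite, 'i) spin_riem \<Rightarrow>
     ('m, 's, 'i) spinor_field \<Rightarrow> ('m, 's, 'i) spinor_field \<Rightarrow> 'm vfield" where
  "spinor_vfield M \<psi>1 \<psi>2 = (\<lambda>p. sharp M p (spinor_oneform M \<psi>1 \<psi>2 p))"

definition spinor_endo ::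
  "('m::topological_space, 'n::finite, 's::finite, 'i) spin_riem \<Rightarrow>
     ('m, 's, 'i) spinor_field \<Rightarrow> ('m, 's, 'i) spinor_field \<Rightarrow> 'm endofield" where
  "spinor_endo M \<psi>1 \<psi>2 = (\<lambda>p v f.
     - (1/2) * sharp M p (\<lambda>w. ext_deriv (atl M) (spinor_oneform M \<psi>1 \<psi>2) p v w) f)"

definition spinor_length ::
  "('m::topological_space, 'n::finite, 's::finite, 'i) spin_riem \<Rightarrow>
     ('m, 's, 'i) spinor_field \<Rightarrow> ('m, 's, 'i) spinor_field \<Rightarrow> 'm \<Rightarrow> real" where
  "spinor_length M \<psi>1 \<psi>2 p =
     sqrt (met M p (spinor_vfield M \<psi>1 \<psi>2 p) (spinor_vfield M \<psi>1 \<psi>2 p))"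

definition locally_constant :: "('m::topological_space \<Rightarrow> 'b) \<Rightarrow> bool" where
  "locally_constant f \<longleftrightarrow> (\<forall>p. \<exists>U. open U \<and> p \<in> U \<and> f constant_on U)"

end

theory Submission
  imports Defs
begin

text \<open>
  Write \<open>\<kappa>\<close> for the Killing number, and \<open>\<eta>\<close>, \<open>\<xi>\<close> for the 1-form and the vector field of the two spinors before
  division by the length. Clifford multiplication is parallel and skew, so the Killing equation gives
  \<open>(\<nabla>\<^sub>X \<eta>)(Y) = \<kappa> Re\<langle>\<psi>\<^sub>1, (Y X - X Y) \<psi>\<^sub>2\<rangle>\<close>. This is skew in \<open>X\<close> and \<open>Y\<close>; hence \<open>\<xi>\<close> is a Killing field,
  \<open>d\<eta>(X,Y) = 2 g(\<nabla>\<^sub>X \<xi>, Y)\<close>, and the endomorphism field of the two spinors is \<open>-\<nabla>\<xi>\<close>. Differentiating once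
  more, the Killing equation puts the commutator of \<open>Z Y - Y Z\<close> with \<open>X\<close> between the spinors, with the
  factor \<open>\<kappa>\<^sup>2 = 1/4\<close>. In the Clifford algebra that commutator equals \<open>4 g(X,Z) Y - 4 g(X,Y) Z\<close>, so
  \<open>\<nabla>\<^sup>2\<^sub>X\<^sub>,\<^sub>Y \<xi> = \<eta>(Y) X - g(X,Y) \<xi>\<close>, and this is the Sasaki condition for \<open>\<phi> = -\<nabla>\<xi>\<close>. All these
  equations are linear in \<open>\<xi>\<close>, so they persist after division by the locally constant length, which
  makes \<open>\<xi>\<close> a unit field.

  The computation is carried out in the orthonormal frames \<open>e\<^sub>a\<close> of the spin structure, where spinors are
  vector-valued functions. There \<open>\<eta>(e\<^sub>a)\<close> and \<open>(\<nabla>\<^sub>a \<eta>)(e\<^sub>b)\<close> are functions of the form \<open>Re\<langle>\<psi>\<^sub>1, A \<psi>\<^sub>2\<rangle>\<close> with a constant matrix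
  \<open>A\<close>, and their derivatives are given by commutators of \<open>A\<close> (\<open>derivative_bilinear\<close>,
  \<open>derivative_eta_coeff\<close>, \<open>derivative_deta_coeff\<close>). The purely algebraic inputs are
  \<open>gamma_double_commutator\<close> and \<open>conn_term_gamma\<close>. The geometric conclusions are \<open>D_xi_skew\<close>,
  \<open>D_D_xi\<close> and \<open>spinor_endo_eq\<close>, and \<open>sasakian_structure_rescale\<close> assembles them.

  Tangent vectors are derivations and fields are given only locally, so the calculus behind this is
  developed for germs: derivations and connections do not change when their argument is modified away
  from the point (\<open>tangent_cong\<close>, \<open>affine_connection_cong\<close>).
\<close>

section \<open>Calculus of smooth functions\<close>

text \<open>The recursion defining \<open>Ck_on\<close> differentiates at points of the ambient space, so it only respects
  equality on \<open>S\<close> because an open set contains the germs at its points.\<close>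

lemma Ck_on_cong:
  assumes "open S" "\<And>x. x \<in> S \<Longrightarrow> f x = g x"
  shows "Ck_on k S f \<longleftrightarrow> Ck_on k S g"
  using assms(2)
proof (induction k arbitrary: f g)
  case 0
  then show ?case by (simp cong: continuous_on_cong)
next
  case (Suc k)
  have "(f has_derivative L) (at x) \<longleftrightarrow> (g has_derivative L) (at x)" if "x \<in> S" for x L
    using has_derivative_transform_within_open[of f L x UNIV S g]
      has_derivative_transform_within_open[of g L x UNIV S f] that Suc.prems assms(1) by auto
  then have *: "f differentiable (at x) \<longleftrightarrow> g differentiable (at x)"
    "frechet_derivative f (at x) = frechet_derivative g (at x)" if "x \<in> S" for x
    using that unfolding differentiable_def frechet_derivative_def by presburger+
  have "Ck_on k S (\<lambda>x. frechet_derivative f (at x) v) \<longleftrightarrow>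
      Ck_on k S (\<lambda>x. frechet_derivative g (at x) v)" for v
    by (rule Suc.IH) (simp only: *)
  then show ?case
    unfolding Ck_on.simps using *(1) by blast
qed

lemma Ck_on_subset: "Ck_on k S f \<Longrightarrow> T \<subseteq> S \<Longrightarrow> Ck_on k T f"
  by (induction k arbitrary: f) (auto intro: continuous_on_subset)

lemma Ck_on_SucD: "Ck_on (Suc k) S f \<Longrightarrow> Ck_on k S f"
proof (induction k arbitrary: f)
  case 0
  then show ?case
    by (auto intro!: continuous_at_imp_continuous_on differentiable_imp_continuous_within)
next
  case (Suc k)
  have "Ck_on (Suc k) S (\<lambda>x. frechet_derivative f (at x) v)" for v
    using Suc.prems unfolding Ck_on.simps(2)[of "Suc k"] by blast
  then have "Ck_on k S (\<lambda>x. frechet_derivative f (at x) v)" for v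
    by (rule Suc.IH)
  then show ?case
    using Suc.prems unfolding Ck_on.simps(2)[of k] Ck_on.simps(2)[of "Suc k"] by blast
qed

lemma Ck_on_local:
  assumes "\<And>x. x \<in> S \<Longrightarrow> \<exists>T. open T \<and> x \<in> T \<and> Ck_on k T f"
  shows "Ck_on k S f"
  using assms
proof (induction k arbitrary: f)
  case 0
  have "continuous (at x) f" if "x \<in> S" for x
    using 0[OF that] continuous_on_eq_continuous_at by auto
  then show ?case
    by (simp add: continuous_at_imp_continuous_on)
next
  case (Suc k)
  have "f differentiable at x" if "x \<in> S" for x
    using Suc.prems[OF that] by auto
  moreover have "Ck_on k S (\<lambda>x. frechet_derivative f (at x) v)" for v
  proof (rule Suc.IH)
    fix x assume "x \<in> S"
    then obtain T where "open T" "x \<in> T" "Ck_on (Suc k) T f"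
      using Suc.prems by blast
    then show "\<exists>T. open T \<and> x \<in> T \<and> Ck_on k T (\<lambda>x. frechet_derivative f (at x) v)"
      unfolding Ck_on.simps by blast
  qed
  ultimately show ?case
    by simp
qed

text \<open>Frechet derivatives found by the differentiation rules may replace the chosen
  \<open>frechet_derivative\<close>; the closure properties below are inductions on this rule.\<close>

lemma Ck_on_SucI:
  assumes "open S" "\<And>x. x \<in> S \<Longrightarrow> (f has_derivative D x) (at x)"
    and "\<And>v. Ck_on k S (\<lambda>x. D x v)"
  shows "Ck_on (Suc k) S f"
proof -
  have "Ck_on k S (\<lambda>x. frechet_derivative f (at x) v)" for v
  proof -
    have "frechet_derivative f (at x) v = D x v" if "x \<in> S" for x
      using frechet_derivative_at[OF assms(2)[OF that]] by simp
    then show ?thesis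
      using Ck_on_cong[OF assms(1), of "\<lambda>x. frechet_derivative f (at x) v" "\<lambda>x. D x v" k]
        assms(3)[of v] by simp
  qed
  moreover have "f differentiable (at x)" if "x \<in> S" for x
    using assms(2)[OF that] unfolding differentiable_def by blast
  ultimately show ?thesis
    unfolding Ck_on.simps by blast
qed

lemma Ck_on_SucE:
  assumes "Ck_on (Suc k) S f"
  shows "\<And>x. x \<in> S \<Longrightarrow> (f has_derivative frechet_derivative f (at x)) (at x)"
    and "\<And>v. Ck_on k S (\<lambda>x. frechet_derivative f (at x) v)"
proof -
  show "(f has_derivative frechet_derivative f (at x)) (at x)" if "x \<in> S" for x
    using assms that unfolding Ck_on.simps by (metis frechet_derivative_works)
  show "Ck_on k S (\<lambda>x. frechet_derivative f (at x) v)" for v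
    using assms unfolding Ck_on.simps by metis
qed

lemma Ck_on_bounded_linear:
  assumes "open S" "bounded_linear L" "Ck_on k S f"
  shows "Ck_on k S (\<lambda>x. L (f x))"
  using assms(3)
proof (induction k arbitrary: f)
  case 0
  then show ?case
    using bounded_linear.continuous_on[OF assms(2), of S f] by simp
next
  case (Suc k)
  show ?case
  proof (rule Ck_on_SucI[OF assms(1)])
    show "((\<lambda>x. L (f x)) has_derivative (\<lambda>v. L (frechet_derivative f (at x) v))) (at x)"
      if "x \<in> S" for x
      by (rule bounded_linear.has_derivative[OF assms(2) Ck_on_SucE(1)[OF Suc.prems that]])
    show "Ck_on k S (\<lambda>x. L (frechet_derivative f (at x) v))" for v
      by (rule Suc.IH[OF Ck_on_SucE(2)[OF Suc.prems]])
  qed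
qed

lemma Ck_on_add:
  assumes "open S" "Ck_on k S f" "Ck_on k S g"
  shows "Ck_on k S (\<lambda>x. f x + g x)"
  using assms(2,3)
proof (induction k arbitrary: f g)
  case 0
  then show ?case by (simp add: continuous_on_add)
next
  case (Suc k)
  show ?case
  proof (rule Ck_on_SucI[OF assms(1)])
    show "((\<lambda>x. f x + g x) has_derivative
        (\<lambda>v. frechet_derivative f (at x) v + frechet_derivative g (at x) v)) (at x)"
      if "x \<in> S" for x
      by (rule has_derivative_add[OF Suc.prems[THEN Ck_on_SucE(1), OF that]])
    show "Ck_on k S (\<lambda>x. frechet_derivative f (at x) v + frechet_derivative g (at x) v)" for v
      by (rule Suc.IH[OF Suc.prems[THEN Ck_on_SucE(2)]])
  qed
qed

lemma Ck_on_bilinear: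
  assumes "open S" "bounded_bilinear B" "Ck_on k S f" "Ck_on k S g"
  shows "Ck_on k S (\<lambda>x. B (f x) (g x))"
  using assms(3,4)
proof (induction k arbitrary: f g)
  case 0
  then show ?case
    using bounded_bilinear.continuous_on[OF assms(2), of S f g] by simp
next
  case (Suc k)
  show ?case
  proof (rule Ck_on_SucI[OF assms(1)])
    show "((\<lambda>x. B (f x) (g x)) has_derivative
        (\<lambda>v. B (f x) (frechet_derivative g (at x) v) + B (frechet_derivative f (at x) v) (g x)))
        (at x)"
      if "x \<in> S" for x
      by (rule bounded_bilinear.FDERIV[OF assms(2) Suc.prems[THEN Ck_on_SucE(1), OF that]])
    show "Ck_on k S (\<lambda>x. B (f x) (frechet_derivative g (at x) v)
        + B (frechet_derivative f (at x) v) (g x))" for v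
      by (rule Ck_on_add[OF assms(1) Suc.IH[OF Ck_on_SucD[OF Suc.prems(1)] Ck_on_SucE(2)[OF Suc.prems(2)]]
        Suc.IH[OF Ck_on_SucE(2)[OF Suc.prems(1)] Ck_on_SucD[OF Suc.prems(2)]]])
  qed
qed

lemma Ck_on_const: "Ck_on k S (\<lambda>x. c)"
  by (induction k arbitrary: c) auto

section \<open>Smoothness near a point of a manifold\<close>

locale smooth_manifold =
  fixes A :: "('m::topological_space, 'n::finite) atlas"
  assumes atlas: "smooth_atlas A"
begin

lemma open_chart_image:
  assumes "(V, c) \<in> A" "open U"
  shows "open (c ` (U \<inter> V))"
proof -
  have V: "open V" "open (c ` V)" "homeomorphism V (c ` V) c (inv_into V c)"
    using assms(1) atlas unfolding smooth_atlas_def by auto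
  have "openin (top_of_set V) (U \<inter> V)"
    using assms(2) V(1) by (simp add: openin_open_eq open_Int)
  then have "openin (top_of_set (c ` V)) (c ` (U \<inter> V))"
    using homeomorphism_imp_open_map[OF V(3)] by blast
  then show ?thesis
    using V(2) by (simp add: openin_open_eq)
qed

lemma inv_chart_mem:
  assumes "(V, c) \<in> A" "y \<in> c ` (U \<inter> V)"
  shows "inv_into V c y \<in> U"
proof -
  have "homeomorphism V (c ` V) c (inv_into V c)"
    using assms atlas unfolding smooth_atlas_def by auto
  then show ?thesis
    using assms(2) by (auto simp: homeomorphism_def)
qed

lemma smooth_fun_cong:
  assumes "\<And>p. p \<in> U \<Longrightarrow> f p = g p"
  shows "smooth_fun A U f \<longleftrightarrow> smooth_fun A U g"
proof -
  have "Cinf_on (c ` (U \<inter> V)) (f \<circ> inv_into V c) \<longleftrightarrow> Cinf_on (c ` (U \<inter> V)) (g \<circ> inv_into V c)"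
    if "open U" "(V, c) \<in> A" for V c
    unfolding Cinf_on_def
    using that assms
    by (intro all_cong1 Ck_on_cong) (auto simp: open_chart_image intro!: assms inv_chart_mem)
  then show ?thesis
    unfolding smooth_fun_def by auto
qed

lemma smooth_fun_subset: "smooth_fun A U f \<Longrightarrow> W \<subseteq> U \<Longrightarrow> open W \<Longrightarrow> smooth_fun A W f"
  unfolding smooth_fun_def Cinf_on_def by (fast intro: Ck_on_subset)

text \<open>Smoothness is a local property. This reduces every smoothness question to germs at a point, and
  gluing over the patches of a spin structure becomes automatic.\<close>

lemma smooth_fun_iff_near:
  "smooth_fun A U f \<longleftrightarrow> open U \<and> (\<forall>p\<in>U. smooth_near A p f)"
proof
  show "smooth_fun A U f \<Longrightarrow> open U \<and> (\<forall>p\<in>U. smooth_near A p f)"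
    by (auto simp: smooth_near_def smooth_fun_def)
  assume *: "open U \<and> (\<forall>p\<in>U. smooth_near A p f)"
  have "Ck_on k (c ` (U \<inter> V)) (f \<circ> inv_into V c)" if Vc: "(V, c) \<in> A" for V c k
  proof (rule Ck_on_local)
    fix y assume "y \<in> c ` (U \<inter> V)"
    then obtain p where p: "p \<in> U" "p \<in> V" "y = c p" by auto
    then obtain W where W: "p \<in> W" "smooth_fun A W f"
      using * by (auto simp: smooth_near_def)
    then show "\<exists>T. open T \<and> y \<in> T \<and> Ck_on k T (f \<circ> inv_into V c)"
      using Vc p open_chart_image[OF Vc]
      by (intro exI[of _ "c ` (W \<inter> V)"]) (auto simp: smooth_fun_def Cinf_on_def)
  qed
  then show "smooth_fun A U f"
    using * by (auto simp: smooth_fun_def Cinf_on_def)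
qed

lemma smooth_near_cong:
  fixes f g :: "'m \<Rightarrow> 'b::real_normed_vector"
  assumes "eventually (\<lambda>q. f q = g q) (nhds p)"
  shows "smooth_near A p f \<longleftrightarrow> smooth_near A p g"
proof -
  have "smooth_near A p g" if sm: "smooth_near A p f" and ev: "eventually (\<lambda>q. f q = g q) (nhds p)"
    for f g :: "'m \<Rightarrow> 'b"
  proof -
    obtain U where U: "p \<in> U" "smooth_fun A U f" using sm by (auto simp: smooth_near_def)
    obtain W where W: "open W" "p \<in> W" "\<And>q. q \<in> W \<Longrightarrow> f q = g q"
      using ev by (auto simp: eventually_nhds)
    have "smooth_fun A (U \<inter> W) f"
      using U W smooth_fun_subset[of U f "U \<inter> W"] by (auto simp: smooth_fun_def)
    then have "smooth_fun A (U \<inter> W) g"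
      using W smooth_fun_cong[of "U \<inter> W" f g] by auto
    then show ?thesis using U W by (auto simp: smooth_near_def)
  qed
  moreover have "eventually (\<lambda>q. g q = f q) (nhds p)"
    using assms by (simp add: eq_commute)
  ultimately show ?thesis using assms by blast
qed

lemma smooth_near_const: "smooth_near A p (\<lambda>q. r)"
  unfolding smooth_near_def smooth_fun_def Cinf_on_def
  by (intro exI[of _ UNIV]) (auto simp: o_def Ck_on_const)

lemma smooth_near_bounded_linear:
  assumes "bounded_linear L" "smooth_near A p f"
  shows "smooth_near A p (\<lambda>q. L (f q))"
proof -
  obtain U where "p \<in> U" "smooth_fun A U f"
    using assms by (auto simp: smooth_near_def)
  then show ?thesis
    unfolding smooth_near_def smooth_fun_def Cinf_on_def o_def
    by (intro exI[of _ U]) (auto intro!: Ck_on_bounded_linear[OF _ assms(1)] open_chart_image)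
qed

lemma smooth_near_bilinear:
  assumes "bounded_bilinear B" "smooth_near A p f" "smooth_near A p g"
  shows "smooth_near A p (\<lambda>q. B (f q) (g q))"
proof -
  obtain U W where "p \<in> U" "p \<in> W" "smooth_fun A U f" "smooth_fun A W g"
    using assms by (auto simp: smooth_near_def)
  then have "p \<in> U \<inter> W" "smooth_fun A (U \<inter> W) f" "smooth_fun A (U \<inter> W) g"
    using smooth_fun_subset[of U f "U \<inter> W"] smooth_fun_subset[of W g "U \<inter> W"]
    by (auto simp: smooth_fun_def)
  then show ?thesis
    unfolding smooth_near_def smooth_fun_def Cinf_on_def o_def
    by (intro exI[of _ "U \<inter> W"]) (auto intro!: Ck_on_bilinear[OF _ assms(1)] open_chart_image)
qed

lemma smooth_near_add:
  assumes "smooth_near A p f" "smooth_near A p g"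
  shows "smooth_near A p (\<lambda>q. f q + g q)"
proof -
  obtain U W where "p \<in> U" "p \<in> W" "smooth_fun A U f" "smooth_fun A W g"
    using assms by (auto simp: smooth_near_def)
  then have "p \<in> U \<inter> W" "smooth_fun A (U \<inter> W) f" "smooth_fun A (U \<inter> W) g"
    using smooth_fun_subset[of U f "U \<inter> W"] smooth_fun_subset[of W g "U \<inter> W"]
    by (auto simp: smooth_fun_def)
  then show ?thesis
    unfolding smooth_near_def smooth_fun_def Cinf_on_def o_def
    by (intro exI[of _ "U \<inter> W"]) (auto intro!: Ck_on_add open_chart_image)
qed

lemmas smooth_near_mult = smooth_near_bilinear[OF bounded_bilinear_mult]
lemmas smooth_near_inner = smooth_near_bilinear[OF bounded_bilinear_inner]

lemma smooth_near_sum: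
  "(\<And>a. a \<in> I \<Longrightarrow> smooth_near A p (f a)) \<Longrightarrow> smooth_near A p (\<lambda>q. \<Sum>a\<in>I. f a q)"
  by (induction I rule: infinite_finite_induct)
    (auto intro!: smooth_near_add smooth_near_const)

section \<open>Tangent vectors and vector fields\<close>

lemma tangentD:
  assumes "v \<in> tangent_space A p"
  shows tangent_add: "\<And>f h. smooth_near A p f \<Longrightarrow> smooth_near A p h \<Longrightarrow> v (\<lambda>q. f q + h q) = v f + v h"
    and tangent_mult: "\<And>f h. smooth_near A p f \<Longrightarrow> smooth_near A p h \<Longrightarrow>
      v (\<lambda>q. f q * h q) = v f * h p + f p * v h"
    and tangent_scale: "\<And>f r. smooth_near A p f \<Longrightarrow> v (\<lambda>q. r * f q) = r * v f"
    and tangent_nonsmooth: "\<And>f. \<not> smooth_near A p f \<Longrightarrow> v f = 0"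
  using assms by (auto simp: tangent_space_def)

lemma tangent_const:
  assumes "v \<in> tangent_space A p"
  shows "v (\<lambda>q. r) = 0"
proof -
  have "v (\<lambda>q. 1) = 0"
    using tangent_mult[OF assms smooth_near_const[where r=1] smooth_near_const[where r=1]] by simp
  then show ?thesis
    using tangent_scale[OF assms smooth_near_const[where r=1], of r] by simp
qed

text \<open>A derivation only sees germs: functions that agree near \<open>p\<close> become equal after multiplication by the
  indicator of an open neighbourhood, which is smooth near \<open>p\<close> with value 1, and the product rule
  recovers the derivatives of the functions themselves.\<close>

lemma tangent_cong:
  assumes v: "v \<in> tangent_space A p" and ev: "eventually (\<lambda>q. f q = g q) (nhds p)"
  shows "v f = v g"
proof (cases "smooth_near A p f")
  case True
  then have g: "smooth_near A p g" using smooth_near_cong[OF ev] by simp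
  obtain U where U: "open U" "p \<in> U" "\<And>q. q \<in> U \<Longrightarrow> f q = g q"
    using ev by (auto simp: eventually_nhds)
  define h :: "'m \<Rightarrow> real" where "h = indicator U"
  have "eventually (\<lambda>q. h q = 1) (nhds p)"
    using U by (auto simp: h_def eventually_nhds)
  then have h: "smooth_near A p h"
    using smooth_near_cong[of h "\<lambda>q. 1" p] smooth_near_const by simp
  have "(\<lambda>q. f q * h q) = (\<lambda>q. g q * h q)"
    using U by (auto simp: h_def indicator_def fun_eq_iff)
  then have "v (\<lambda>q. f q * h q) = v (\<lambda>q. g q * h q)" by (rule arg_cong)
  moreover have "h p = 1" "f p = g p"
    using U by (auto simp: h_def)
  ultimately show ?thesis
    using tangent_mult[OF v True h] tangent_mult[OF v g h] by simp
next
  case False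
  then show ?thesis
    using smooth_near_cong[OF ev] tangent_nonsmooth[OF v] by simp
qed

lemma tangent_locally_const:
  assumes "v \<in> tangent_space A p" "eventually (\<lambda>q. f q = r) (nhds p)"
  shows "v f = 0"
  using tangent_cong[OF assms] tangent_const[OF assms(1)] by simp

lemma tangent_sum:
  assumes "v \<in> tangent_space A p"
  shows "(\<And>a. a \<in> I \<Longrightarrow> smooth_near A p (f a)) \<Longrightarrow> v (\<lambda>q. \<Sum>a\<in>I. f a q) = (\<Sum>a\<in>I. v (f a))"
  by (induction I rule: infinite_finite_induct)
    (simp_all add: tangent_const[OF assms] tangent_add[OF assms] smooth_near_sum)

lemma tangent_space_zero: "(\<lambda>f. 0) \<in> tangent_space A p"
  by (simp add: tangent_space_def)

lemma tangent_space_combine: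
  assumes "v \<in> tangent_space A p" "w \<in> tangent_space A p"
  shows "(\<lambda>f. a * v f + b * w f) \<in> tangent_space A p"
  using assms unfolding tangent_space_def by (simp add: algebra_simps)

lemma tangent_space_scale:
  "v \<in> tangent_space A p \<Longrightarrow> (\<lambda>f. a * v f) \<in> tangent_space A p"
  using tangent_space_combine[of v p v a 0] by simp

lemma tangent_space_diff:
  "v \<in> tangent_space A p \<Longrightarrow> w \<in> tangent_space A p \<Longrightarrow> (\<lambda>f. v f - w f) \<in> tangent_space A p"
  using tangent_space_combine[of v p w 1 "-1"] by simp

lemma tangent_space_sum:
  "(\<And>a. a \<in> I \<Longrightarrow> v a \<in> tangent_space A p) \<Longrightarrow> (\<lambda>f. \<Sum>a\<in>I. x a * v a f) \<in> tangent_space A p"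
proof (induction I rule: infinite_finite_induct)
  case (insert a I)
  then show ?case
    using tangent_space_combine[of "v a" p "\<lambda>f. \<Sum>a\<in>I. x a * v a f" "x a" 1] by simp
qed (auto simp: tangent_space_zero)

text \<open>Restricting a function to a smaller neighbourhood turns the condition on all open subsets of \<open>U\<close>
  into a condition on germs.\<close>

lemma vector_field_iff_near:
  "vector_field A U X \<longleftrightarrow> open U \<and> (\<forall>p\<in>U. X p \<in> tangent_space A p \<and>
     (\<forall>f. smooth_near A p f \<longrightarrow> smooth_near A p (\<lambda>q. X q f)))"
proof (intro iffI)
  assume X: "vector_field A U X"
  have "smooth_near A p (\<lambda>q. X q f)" if p: "p \<in> U" and f: "smooth_near A p f" for p f
  proof -
    obtain W where W: "p \<in> W" "smooth_fun A W f" using f by (auto simp: smooth_near_def)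
    have "smooth_fun A (W \<inter> U) f"
      using W X smooth_fun_subset[of W f "W \<inter> U"] by (auto simp: smooth_fun_def vector_field_def)
    then have "smooth_fun A (W \<inter> U) (\<lambda>q. X q f)"
      using X unfolding vector_field_def by auto
    then show ?thesis using p W by (auto simp: smooth_near_def)
  qed
  then show "open U \<and> (\<forall>p\<in>U. X p \<in> tangent_space A p \<and>
     (\<forall>f. smooth_near A p f \<longrightarrow> smooth_near A p (\<lambda>q. X q f)))"
    using X by (auto simp: vector_field_def)
next
  assume *: "open U \<and> (\<forall>p\<in>U. X p \<in> tangent_space A p \<and>
     (\<forall>f. smooth_near A p f \<longrightarrow> smooth_near A p (\<lambda>q. X q f)))"
  show "vector_field A U X"
    unfolding vector_field_def
  proof (intro conjI allI impI ballI)
    fix V f assume "V \<subseteq> U" "smooth_fun A V (f :: 'm \<Rightarrow> real)"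
    then show "smooth_fun A V (\<lambda>p. X p f)"
      using * unfolding smooth_fun_iff_near by blast
  qed (use * in auto)
qed

lemma vector_field_nearI: "vector_field A U X \<Longrightarrow> p \<in> U \<Longrightarrow> vector_field_near A p X"
  by (auto simp: vector_field_near_def)

lemma vector_field_near_tangent: "vector_field_near A p X \<Longrightarrow> X p \<in> tangent_space A p"
  by (auto simp: vector_field_near_def vector_field_def)

lemma vector_field_near_smooth:
  "vector_field_near A p X \<Longrightarrow> smooth_near A p f \<Longrightarrow> smooth_near A p (\<lambda>q. X q f)"
  by (auto simp: vector_field_near_def vector_field_iff_near)

lemma vector_field_near_eventually:
  "vector_field_near A p X \<Longrightarrow> eventually (\<lambda>q. vector_field_near A q X) (nhds p)"
  unfolding vector_field_near_def eventually_nhds vector_field_def by blast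

lemma vector_field_near_eventually_tangent:
  "vector_field_near A p X \<Longrightarrow> eventually (\<lambda>q. X q \<in> tangent_space A q) (nhds p)"
  using vector_field_near_eventually vector_field_near_tangent
  by (metis (mono_tags, lifting) eventually_mono)

lemma vector_field_restrict: "vector_field A U X \<Longrightarrow> open W \<Longrightarrow> W \<subseteq> U \<Longrightarrow> vector_field A W X"
  by (auto simp: vector_field_iff_near)

lemma vector_field_near2:
  assumes "vector_field_near A p X" "vector_field_near A p Y"
  obtains U where "p \<in> U" "vector_field A U X" "vector_field A U Y"
proof -
  obtain U W where "p \<in> U" "vector_field A U X" "p \<in> W" "vector_field A W Y"
    using assms by (auto simp: vector_field_near_def)
  then show ?thesis
    using that[of "U \<inter> W"] vector_field_restrict[of U X "U \<inter> W"] vector_field_restrict[of W Y "U \<inter> W"]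
    by (auto simp: vector_field_def)
qed

lemma vector_field_sum:
  assumes "open U" "\<And>a. a \<in> I \<Longrightarrow> vector_field A U (X a)"
    and "\<And>a p. a \<in> I \<Longrightarrow> p \<in> U \<Longrightarrow> smooth_near A p (h a)"
  shows "vector_field A U (\<lambda>p f. \<Sum>a\<in>I. h a p * X a p f)"
  using assms unfolding vector_field_iff_near
  by (auto intro!: smooth_near_sum smooth_near_mult tangent_space_sum)

lemma vector_field_near_cong:
  assumes X: "vector_field_near A p X" and ev: "eventually (\<lambda>q. X q = Y q) (nhds p)"
  shows "vector_field_near A p Y"
proof -
  obtain U where U: "p \<in> U" "vector_field A U X" using X by (auto simp: vector_field_near_def)
  obtain W where W: "open W" "p \<in> W" "\<And>q. q \<in> W \<Longrightarrow> X q = Y q"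
    using ev by (auto simp: eventually_nhds)
  have UW: "vector_field A (U \<inter> W) X"
    using U W vector_field_restrict[of U X "U \<inter> W"] by (auto simp: vector_field_def)
  have "vector_field A (U \<inter> W) Y"
    unfolding vector_field_iff_near
  proof (intro conjI ballI allI impI)
    fix q f assume q: "q \<in> U \<inter> W" "smooth_near A q (f :: 'm \<Rightarrow> real)"
    have "eventually (\<lambda>q'. X q' f = Y q' f) (nhds q)"
      using W q by (auto simp: eventually_nhds)
    then show "smooth_near A q (\<lambda>q. Y q f)"
      using smooth_near_cong[of "\<lambda>q. X q f" "\<lambda>q. Y q f" q] UW q
      by (auto simp: vector_field_iff_near)
  qed (use UW W in \<open>auto simp: vector_field_iff_near\<close>)
  then show ?thesis using U W by (auto simp: vector_field_near_def)
qed

lemma vector_field_near_scale: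
  assumes "vector_field_near A p X" "smooth_near A p h"
  shows "vector_field_near A p (\<lambda>q f. h q * X q f)"
proof -
  obtain U where U: "p \<in> U" "vector_field A U X" using assms by (auto simp: vector_field_near_def)
  obtain W where W: "p \<in> W" "smooth_fun A W h" using assms by (auto simp: smooth_near_def)
  have "vector_field A (U \<inter> W) (\<lambda>q f. h q * X q f)"
    using U W unfolding vector_field_iff_near smooth_fun_iff_near
    by (auto intro!: smooth_near_mult tangent_space_scale)
  then show ?thesis using U W by (auto simp: vector_field_near_def)
qed

text \<open>A connection only sees the germ of the vector field it differentiates: multiply by the
  indicator of a neighbourhood and use the Leibniz rule.\<close>

lemma affine_connection_cong:
  assumes D: "affine_connection A D" and Y: "vector_field_near A p Y"
    and ev: "eventually (\<lambda>q. Y q = Z q) (nhds p)" and v: "v \<in> tangent_space A p"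
  shows "D Y p v = D Z p v"
proof -
  have Z: "vector_field_near A p Z" using vector_field_near_cong[OF Y ev] .
  obtain U where U: "open U" "p \<in> U" "\<And>q. q \<in> U \<Longrightarrow> Y q = Z q"
    using ev by (auto simp: eventually_nhds)
  define h :: "'m \<Rightarrow> real" where "h = indicator U"
  have "eventually (\<lambda>q. h q = 1) (nhds p)"
    using U by (auto simp: h_def eventually_nhds)
  then have h: "smooth_near A p h" and vh: "v h = 0"
    using smooth_near_cong[of h "\<lambda>q. 1" p] smooth_near_const tangent_locally_const[OF v] by auto
  have hp: "h p = 1" using U by (simp add: h_def)
  have eq: "(\<lambda>q f. h q * Y q f) = (\<lambda>q f. h q * Z q f)"
    using U by (auto simp: h_def indicator_def fun_eq_iff)
  have "D (\<lambda>q f. h q * Y q f) p v = D Y p v" if "vector_field_near A p Y" for Y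
    using D that h v unfolding affine_connection_def by (simp add: vh hp)
  from this[OF Y] this[OF Z] eq show ?thesis by simp
qed

end

section \<open>Riemannian metrics and the Levi-Civita connection\<close>

locale riemannian =
  fixes M :: "('m::{t2_space, second_countable_topology}, 'n::finite, 'z) riem_scheme"
  assumes riem: "riemannian_manifold M"

sublocale riemannian \<subseteq> smooth_manifold "atl M"
  using riem by unfold_locales (simp add: riemannian_manifold_def)

context riemannian
begin

lemma met_sym: "u \<in> tspace M p \<Longrightarrow> v \<in> tspace M p \<Longrightarrow> met M p u v = met M p v u"
  using riem by (simp add: riemannian_manifold_def)

lemma met_combine:
  "u \<in> tspace M p \<Longrightarrow> v \<in> tspace M p \<Longrightarrow> w \<in> tspace M p \<Longrightarrow>
    met M p (\<lambda>f. a * u f + b * v f) w = a * met M p u w + b * met M p v w"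
  using riem by (simp add: riemannian_manifold_def)

lemma met_pos: "v \<in> tspace M p \<Longrightarrow> v \<noteq> (\<lambda>f. 0) \<Longrightarrow> met M p v v > 0"
  using riem by (simp add: riemannian_manifold_def)

lemma met_scale: "u \<in> tspace M p \<Longrightarrow> w \<in> tspace M p \<Longrightarrow> met M p (\<lambda>f. a * u f) w = a * met M p u w"
  using met_combine[of u p u w a 0] by simp

lemma met_zero: "w \<in> tspace M p \<Longrightarrow> met M p (\<lambda>f. 0) w = 0"
  using met_scale[of w p w 0] by simp

lemma met_diff:
  "u \<in> tspace M p \<Longrightarrow> v \<in> tspace M p \<Longrightarrow> w \<in> tspace M p \<Longrightarrow>
    met M p (\<lambda>f. u f - v f) w = met M p u w - met M p v w"
  using met_combine[of u p v w 1 "-1"] by simp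

lemma met_sum:
  assumes "w \<in> tspace M p"
  shows "(\<And>a. a \<in> I \<Longrightarrow> v a \<in> tspace M p) \<Longrightarrow>
    met M p (\<lambda>f. \<Sum>a\<in>I. x a * v a f) w = (\<Sum>a\<in>I. x a * met M p (v a) w)"
proof (induction I rule: infinite_finite_induct)
  case (insert a I)
  then show ?case
    using met_combine[of "v a" p "\<lambda>f. \<Sum>a\<in>I. x a * v a f" w "x a" 1] assms
    by (simp add: tangent_space_sum)
qed (auto simp: met_zero assms)

lemma met_sum_right:
  assumes "w \<in> tspace M p" "\<And>a. a \<in> I \<Longrightarrow> v a \<in> tspace M p"
  shows "met M p w (\<lambda>f. \<Sum>a\<in>I. x a * v a f) = (\<Sum>a\<in>I. x a * met M p w (v a))"
  using assms met_sum[of w p I v x] by (simp add: met_sym[of w p] tangent_space_sum)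

lemma met_eqI:
  assumes "u \<in> tspace M p" "v \<in> tspace M p"
    and "\<And>w. w \<in> tspace M p \<Longrightarrow> met M p u w = met M p v w"
  shows "u = v"
proof -
  let ?d = "\<lambda>f. u f - v f"
  have d: "?d \<in> tspace M p" using assms by (simp add: tangent_space_diff)
  have "met M p ?d ?d = 0" using met_diff[OF assms(1,2) d] assms(3)[OF d] by simp
  then have "?d = (\<lambda>f. 0)" using met_pos[OF d] by force
  then show ?thesis by (simp add: fun_eq_iff)
qed

lemma sharp_eqI:
  assumes "u \<in> tspace M p" "\<And>w. w \<in> tspace M p \<Longrightarrow> met M p u w = \<alpha> w"
  shows "sharp M p \<alpha> = u"
  unfolding sharp_def using assms by (intro the_equality) (auto intro!: met_eqI)

lemma smooth_near_met:
  assumes "vector_field_near (atl M) p X" "vector_field_near (atl M) p Y"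
  shows "smooth_near (atl M) p (\<lambda>q. met M q (X q) (Y q))"
proof -
  obtain U where "p \<in> U" "vector_field (atl M) U X" "vector_field (atl M) U Y"
    using vector_field_near2[OF assms] .
  then show ?thesis
    using riem unfolding riemannian_manifold_def smooth_near_def by metis
qed

context
  fixes p :: 'm and e :: "'n \<Rightarrow> 'm tvec"
  assumes e: "orthonormal_basis M p e"
begin

lemma basis_tangent: "e a \<in> tspace M p"
  using e by (simp add: orthonormal_basis_def)

lemma basis_orthonormal: "met M p (e a) (e b) = (if a = b then 1 else 0)"
  using e by (simp add: orthonormal_basis_def)

lemma basis_eqI:
  assumes "u \<in> tspace M p" "v \<in> tspace M p" "\<And>b. met M p u (e b) = met M p v (e b)"
  shows "u = v"
proof (rule met_eqI[OF assms(1,2)])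
  fix w assume "w \<in> tspace M p"
  then obtain x where "w = (\<lambda>f. \<Sum>a\<in>UNIV. x a * e a f)"
    using e unfolding orthonormal_basis_def by blast
  then show "met M p u w = met M p v w"
    using assms by (simp add: met_sum_right basis_tangent)
qed

lemma basis_expand:
  assumes "v \<in> tspace M p"
  shows "v = (\<lambda>f. \<Sum>a\<in>UNIV. met M p v (e a) * e a f)"
proof (rule basis_eqI[OF assms])
  show "met M p v (e b) = met M p (\<lambda>f. \<Sum>a\<in>UNIV. met M p v (e a) * e a f) (e b)" for b
    by (subst met_sum) (auto simp: basis_tangent basis_orthonormal if_distrib cong: if_cong)
qed (simp add: tangent_space_sum basis_tangent)

lemma met_expand:
  assumes "u \<in> tspace M p" "w \<in> tspace M p"
  shows "met M p u w = (\<Sum>a\<in>UNIV. met M p w (e a) * met M p u (e a))"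
  by (subst basis_expand[OF assms(2)]) (simp add: met_sum_right assms(1) basis_tangent)

end

end

locale levi_civita_manifold = riemannian M
  for M :: "('m::{t2_space, second_countable_topology}, 'n::finite, 'z) riem_scheme" +
  fixes D :: "'m conn"
  assumes lc: "levi_civita M D"
begin

lemma D_affine: "affine_connection (atl M) D"
  using lc by (simp add: levi_civita_def)

lemma D_tangent:
  "vector_field_near (atl M) p Y \<Longrightarrow> v \<in> tspace M p \<Longrightarrow> D Y p v \<in> tspace M p"
  using D_affine by (simp add: affine_connection_def)

lemma D_leibniz:
  "vector_field_near (atl M) p Y \<Longrightarrow> smooth_near (atl M) p h \<Longrightarrow> v \<in> tspace M p \<Longrightarrow>
    D (\<lambda>q f. h q * Y q f) p v = (\<lambda>f. v h * Y p f + h p * D Y p v f)"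
  using D_affine by (simp add: affine_connection_def)

lemma D_vector_field_near:
  assumes "vector_field_near (atl M) p X" "vector_field_near (atl M) p Y"
  shows "vector_field_near (atl M) p (\<lambda>q. D Y q (X q))"
proof -
  obtain U where "p \<in> U" "vector_field (atl M) U X" "vector_field (atl M) U Y"
    using vector_field_near2[OF assms] .
  then show ?thesis
    using D_affine unfolding affine_connection_def vector_field_near_def by metis
qed

lemma D_metric:
  "vector_field_near (atl M) p Y \<Longrightarrow> vector_field_near (atl M) p Z \<Longrightarrow> v \<in> tspace M p \<Longrightarrow>
    v (\<lambda>q. met M q (Y q) (Z q)) = met M p (D Y p v) (Z p) + met M p (Y p) (D Z p v)"
  using lc by (simp add: levi_civita_def)

lemma lie_bracket_D:
  "vector_field_near (atl M) p X \<Longrightarrow> vector_field_near (atl M) p Y \<Longrightarrow>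
    lie_bracket (atl M) X Y p = (\<lambda>f. D Y p (X p) f - D X p (Y p) f)"
  using lc by (simp add: levi_civita_def)

text \<open>For the 1-form dual to \<open>\<xi>\<close> one has
  \<open>d\<eta>(v,w) = g(\<nabla>\<^sub>v \<xi>, w) - g(\<nabla>\<^sub>w \<xi>, v)\<close>, because the connection is metric and torsion free; skewness
  of \<open>\<nabla>\<xi>\<close> merges the two terms. That every tangent vector extends to a local vector field is what
  makes the value of the exterior derivative unique.\<close>

lemma ext_deriv_dual:
  assumes \<xi>: "vector_field (atl M) UNIV \<xi>"
    and skew: "\<And>v w. v \<in> tspace M p \<Longrightarrow> w \<in> tspace M p \<Longrightarrow>
      met M p (D \<xi> p v) w = - met M p (D \<xi> p w) v"
    and dual: "\<And>q v. v \<in> tspace M q \<Longrightarrow> \<eta> q v = met M q (\<xi> q) v"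
    and ext: "\<And>v. v \<in> tspace M p \<Longrightarrow> \<exists>X. vector_field_near (atl M) p X \<and> X p = v"
    and v: "v \<in> tspace M p" and w: "w \<in> tspace M p"
  shows "ext_deriv (atl M) \<eta> p v w = 2 * met M p (D \<xi> p v) w"
proof -
  have \<xi>p: "vector_field_near (atl M) p \<xi>" using vector_field_nearI[OF \<xi>] by simp
  have \<eta>Y: "u (\<lambda>q. \<eta> q (Y q)) = met M p (D \<xi> p u) (Y p) + met M p (\<xi> p) (D Y p u)"
    if "vector_field_near (atl M) p Y" "u \<in> tspace M p" for Y u
  proof -
    have "eventually (\<lambda>q. \<eta> q (Y q) = met M q (\<xi> q) (Y q)) (nhds p)"
      using vector_field_near_eventually_tangent[OF that(1)] by eventually_elim (rule dual)
    then show ?thesis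
      using tangent_cong[OF that(2)] D_metric[OF \<xi>p that] by metis
  qed
  have val: "2 * met M p (D \<xi> p v) w
      = X p (\<lambda>q. \<eta> q (Y q)) - Y p (\<lambda>q. \<eta> q (X q)) - \<eta> p (lie_bracket (atl M) X Y p)"
    if X: "vector_field_near (atl M) p X" and Y: "vector_field_near (atl M) p Y"
      and [simp]: "X p = v" "Y p = w" for X Y
  proof -
    have t: "D Y p v \<in> tspace M p" "D X p w \<in> tspace M p" "\<xi> p \<in> tspace M p"
      using D_tangent X Y v w vector_field_near_tangent[OF \<xi>p] by auto
    have "\<eta> p (lie_bracket (atl M) X Y p)
        = met M p (\<xi> p) (D Y p v) - met M p (\<xi> p) (D X p w)"
      using t met_diff[OF t(1,2,3)]
      by (simp add: lie_bracket_D[OF X Y] dual tangent_space_diff met_sym[of "\<xi> p"])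
    then show ?thesis
      using \<eta>Y[OF Y v] \<eta>Y[OF X w] skew[OF v w] by simp
  qed
  obtain X Y where XY: "vector_field_near (atl M) p X" "X p = v"
      "vector_field_near (atl M) p Y" "Y p = w"
    using ext v w by metis
  show ?thesis
    unfolding ext_deriv_def
  proof (rule the_equality)
    show "\<forall>X Y. vector_field_near (atl M) p X \<longrightarrow> vector_field_near (atl M) p Y \<longrightarrow> X p = v \<longrightarrow>
       Y p = w \<longrightarrow> 2 * met M p (D \<xi> p v) w
      = X p (\<lambda>q. \<eta> q (Y q)) - Y p (\<lambda>q. \<eta> q (X q)) - \<eta> p (lie_bracket (atl M) X Y p)"
      using val by blast
  next
    fix r
    assume "\<forall>X Y. vector_field_near (atl M) p X \<longrightarrow> vector_field_near (atl M) p Y \<longrightarrow> X p = v \<longrightarrow>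
       Y p = w \<longrightarrow> r
      = X p (\<lambda>q. \<eta> q (Y q)) - Y p (\<lambda>q. \<eta> q (X q)) - \<eta> p (lie_bracket (atl M) X Y p)"
    then show "r = 2 * met M p (D \<xi> p v) w"
      using val[of X Y] XY by metis
  qed
qed

text \<open>Torsion freeness gives \<open>[\<xi>,X] = \<nabla>\<^sub>\<xi> X - \<nabla>\<^sub>X \<xi>\<close>; by metric compatibility the \<open>\<nabla>\<^sub>\<xi>\<close>-terms cancel in
  \<open>L\<^sub>\<xi> g\<close>, leaving the symmetric part of \<open>\<nabla>\<xi>\<close>.\<close>

lemma killing_fieldI:
  assumes \<xi>: "vector_field (atl M) UNIV \<xi>"
    and skew: "\<And>p v w. v \<in> tspace M p \<Longrightarrow> w \<in> tspace M p \<Longrightarrow>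
      met M p (D \<xi> p v) w = - met M p (D \<xi> p w) v"
  shows "killing_field M \<xi>"
  unfolding killing_field_def
proof (intro conjI allI impI \<xi>)
  fix p X Y
  assume X: "vector_field_near (atl M) p X" and Y: "vector_field_near (atl M) p Y"
  have \<xi>p: "vector_field_near (atl M) p \<xi>" using vector_field_nearI[OF \<xi>] by simp
  note t = vector_field_near_tangent[OF X] vector_field_near_tangent[OF Y]
    vector_field_near_tangent[OF \<xi>p]
  note Dt = D_tangent[OF X t(3)] D_tangent[OF Y t(3)] D_tangent[OF \<xi>p t(1)] D_tangent[OF \<xi>p t(2)]
  have "met M p (lie_bracket (atl M) \<xi> X p) (Y p) =
      met M p (D X p (\<xi> p)) (Y p) - met M p (D \<xi> p (X p)) (Y p)"
    using t Dt by (simp add: lie_bracket_D[OF \<xi>p X] met_diff)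
  moreover have "met M p (X p) (lie_bracket (atl M) \<xi> Y p) =
      met M p (X p) (D Y p (\<xi> p)) - met M p (D \<xi> p (Y p)) (X p)"
    using t Dt by (simp add: lie_bracket_D[OF \<xi>p Y] met_sym[of "X p"] met_diff tangent_space_diff)
  ultimately show "\<xi> p (\<lambda>q. met M q (X q) (Y q)) - met M p (lie_bracket (atl M) \<xi> X p) (Y p)
      - met M p (X p) (lie_bracket (atl M) \<xi> Y p) = 0"
    using D_metric[OF X Y t(3)] skew[OF t(1,2)] by simp
qed

text \<open>The equation \<open>hess\<close> says \<open>\<nabla>\<^sup>2\<^sub>v\<^sub>,\<^sub>Y \<xi> = g(\<xi>,Y) v - g(v,Y) \<xi>\<close>. It is linear in \<open>\<xi>\<close>, as is the Killing
  equation, so both survive rescaling by the locally constant function \<open>k\<close>, which serves only to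
  make the field a unit field. With \<open>\<phi> = -\<nabla>\<xi>\<close> the equation becomes the Sasaki condition.\<close>

lemma sasakian_structure_rescale:
  assumes \<xi>: "vector_field (atl M) UNIV \<xi>"
    and skew: "\<And>p v w. v \<in> tspace M p \<Longrightarrow> w \<in> tspace M p \<Longrightarrow>
      met M p (D \<xi> p v) w = - met M p (D \<xi> p w) v"
    and hess: "\<And>p Y v f. vector_field_near (atl M) p Y \<Longrightarrow> v \<in> tspace M p \<Longrightarrow>
      D (\<lambda>q. D \<xi> q (Y q)) p v f - D \<xi> p (D Y p v) f
        = met M p (\<xi> p) (Y p) * v f - met M p v (Y p) * \<xi> p f"
    and dual: "\<And>p v. v \<in> tspace M p \<Longrightarrow> \<eta> p v = met M p (\<xi> p) v"
    and \<phi>: "\<And>p v. v \<in> tspace M p \<Longrightarrow> \<phi> p v = (\<lambda>f. - D \<xi> p v f)"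
    and k: "\<And>p. eventually (\<lambda>q. k q = k p) (nhds p)"
    and unit: "\<And>p. k p * k p * met M p (\<xi> p) (\<xi> p) = 1"
  shows "sasakian_structure M D (\<lambda>p f. k p * \<xi> p f) (\<lambda>p v. k p * \<eta> p v) (\<lambda>p v f. k p * \<phi> p v f)"
proof -
  let ?\<xi> = "\<lambda>p f. k p * \<xi> p f"
  have \<xi>p: "vector_field_near (atl M) p \<xi>" for p using vector_field_nearI[OF \<xi>] by simp
  have \<xi>t: "\<xi> p \<in> tspace M p" for p using vector_field_near_tangent[OF \<xi>p] .
  have k_smooth: "smooth_near (atl M) p k" for p
    using smooth_near_cong[OF k] smooth_near_const by blast
  have vk: "v k = 0" if "v \<in> tspace M p" for v p
    using tangent_locally_const[OF that k] .
  \<comment> \<open>The extra constant covers both \<open>k \<xi>\<close> and the minus sign in \<open>\<phi> = -\<nabla>\<xi>\<close>.\<close>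
  have D_scale: "D (\<lambda>q f. c * k q * Y q f) p v = (\<lambda>f. c * k p * D Y p v f)"
    if "vector_field_near (atl M) p Y" "v \<in> tspace M p" for Y p v c
  proof -
    have "smooth_near (atl M) p (\<lambda>q. c * k q)"
      by (intro smooth_near_mult smooth_near_const k_smooth)
    moreover have "v (\<lambda>q. c * k q) = 0"
      using tangent_scale[OF that(2) k_smooth] vk[OF that(2)] by simp
    ultimately show ?thesis
      using D_leibniz[OF that(1) _ that(2), of "\<lambda>q. c * k q"] by simp
  qed
  have vf: "vector_field (atl M) UNIV ?\<xi>"
    using \<xi> k_smooth unfolding vector_field_iff_near
    by (auto intro!: smooth_near_mult tangent_space_scale)
  have D\<xi>: "D ?\<xi> p v = (\<lambda>f. k p * D \<xi> p v f)" if "v \<in> tspace M p" for p v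
    using D_scale[OF \<xi>p that, of 1] by simp
  have kf: "killing_field M ?\<xi>"
  proof (rule killing_fieldI[OF vf])
    fix p v w assume v: "v \<in> tspace M p" and w: "w \<in> tspace M p"
    show "met M p (D ?\<xi> p v) w = - met M p (D ?\<xi> p w) v"
      using met_scale[OF D_tangent[OF \<xi>p v] w, of "k p"] met_scale[OF D_tangent[OF \<xi>p w] v, of "k p"]
        skew[OF v w] by (simp add: D\<xi> v w)
  qed
  have len: "met M p (?\<xi> p) (?\<xi> p) = 1" for p
    using met_scale[OF \<xi>t tangent_space_scale[OF \<xi>t], of p "k p" "k p"]
      met_sym[OF \<xi>t tangent_space_scale[OF \<xi>t], of p "k p"] met_scale[OF \<xi>t \<xi>t, of p "k p"] unit[of p]
    by (simp add: mult.assoc)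
  have main: "cov_deriv_endo D (\<lambda>p v f. k p * \<phi> p v f) p v Y
      = (\<lambda>f. met M p v (Y p) * ?\<xi> p f - k p * \<eta> p (Y p) * v f)"
    if Y: "vector_field_near (atl M) p Y" and v: "v \<in> tspace M p" for p Y v
  proof -
    let ?Z = "\<lambda>q. D \<xi> q (Y q)"
    have Z: "vector_field_near (atl M) p ?Z"
      by (rule D_vector_field_near[OF Y \<xi>p])
    \<comment> \<open>Away from \<open>p\<close> the field \<open>Y\<close> may fail to be tangent, so \<open>\<phi> Y = -\<nabla>\<^sub>Y \<xi>\<close> is only known near \<open>p\<close>.\<close>
    have ev: "eventually (\<lambda>q. (\<lambda>f. - 1 * k q * ?Z q f) = (\<lambda>f. k q * \<phi> q (Y q) f)) (nhds p)"
      using vector_field_near_eventually_tangent[OF Y] by eventually_elim (simp add: \<phi>)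
    have vfn: "vector_field_near (atl M) p (\<lambda>q f. - 1 * k q * ?Z q f)"
      by (rule vector_field_near_scale[OF Z]) (intro smooth_near_mult smooth_near_const k_smooth)
    have "D (\<lambda>q f. k q * \<phi> q (Y q) f) p v = D (\<lambda>q f. - 1 * k q * ?Z q f) p v"
      by (rule affine_connection_cong[OF D_affine vfn ev v, symmetric])
    also have "\<dots> = (\<lambda>f. - 1 * k p * D ?Z p v f)"
      by (rule D_scale[OF Z v])
    finally have "cov_deriv_endo D (\<lambda>p v f. k p * \<phi> p v f) p v Y
        = (\<lambda>f. - k p * (D ?Z p v f - D \<xi> p (D Y p v) f))"
      by (simp add: cov_deriv_endo_def \<phi>[OF D_tangent[OF Y v]] fun_eq_iff algebra_simps)
    also have "\<dots> = (\<lambda>f. met M p v (Y p) * ?\<xi> p f - k p * \<eta> p (Y p) * v f)"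
      by (simp add: hess[OF Y v] dual[OF vector_field_near_tangent[OF Y]] fun_eq_iff algebra_simps)
    finally show ?thesis .
  qed
  show ?thesis
    unfolding sasakian_structure_def
    using kf len main
    by (simp add: dual \<phi> D\<xi> met_scale[OF \<xi>t])
qed

end

section \<open>Clifford multiplication on spinors\<close>

text \<open>The real part of the Hermitian product is the Euclidean inner product of \<open>complex ^ 's\<close>. As the
  1-form of two spinors only involves real parts, everything can be done in the underlying real
  inner product space, where real vectors act by skew operators.\<close>

lemma Re_herm: "Re (herm x y) = x \<bullet> y"
  by (simp add: herm_def inner_vec_def inner_complex_def)

lemma linear_matrix_vector: "linear (\<lambda>u. (A :: complex ^ 'n ^ 'm) *v u)"
  by (rule linearI) (simp_all add: matrix_vector_right_distrib vec_eq_iff matrix_vector_mult_def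
      scaleR_sum_right distrib_left sum.distrib)

lemmas mv_linear_simps = linear_add[OF linear_matrix_vector] linear_diff[OF linear_matrix_vector]
  linear_neg[OF linear_matrix_vector] linear_scale[OF linear_matrix_vector]
  linear_sum[OF linear_matrix_vector]

lemma bounded_linear_matrix_vector: "bounded_linear (\<lambda>u. (A :: complex ^ 'n ^ 'm) *v u)"
  using linear_matrix_vector linear_conv_bounded_linear by blast

lemma scaleR_matrix_vector: "(r *\<^sub>R (A :: complex ^ 'n ^ 'm)) *v u = r *\<^sub>R (A *v u)"
  by (simp add: vec_eq_iff matrix_vector_mult_def scaleR_sum_right)

lemma sum_matrix_vector: "(\<Sum>a\<in>I. (A a :: complex ^ 'n ^ 'm)) *v u = (\<Sum>a\<in>I. A a *v u)"
  by (induction I rule: infinite_finite_induct)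
    (simp_all add: matrix_vector_mult_add_rdistrib)

lemma cliff_apply: "cliff \<gamma> x *v u = (\<Sum>a\<in>UNIV. (x $ a) *\<^sub>R (\<gamma> a *v u))"
  by (simp add: cliff_def sum_matrix_vector scaleR_matrix_vector)

locale clifford_rep =
  fixes \<gamma> :: "'n::finite \<Rightarrow> complex ^ 's::finite ^ 's"
  assumes rep: "spin_rep \<gamma>"
begin

lemma gamma_anticomm:
  "\<gamma> a *v (\<gamma> b *v u) = - (\<gamma> b *v (\<gamma> a *v u)) - (if a = b then 2 else 0) *\<^sub>R u"
proof -
  have "(\<gamma> a ** \<gamma> b + \<gamma> b ** \<gamma> a) *v u = (if a = b then mat (-2) else 0) *v u"
    using rep by (simp add: spin_rep_def)
  moreover have "mat (-2) *v u = - 2 *\<^sub>R u"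
    by (simp add: vec_eq_iff matrix_vector_mult_def mat_def if_distrib[of "\<lambda>x. x * _"]
        scaleR_conv_of_real cong: if_cong)
  ultimately show ?thesis
    by (auto simp: matrix_vector_mult_add_rdistrib matrix_vector_mul_assoc[symmetric]
        eq_neg_iff_add_eq_0 algebra_simps split: if_splits)
qed

lemma gamma_skew: "(\<gamma> a *v x) \<bullet> y = - (x \<bullet> (\<gamma> a *v y))"
  using rep unfolding spin_rep_def by (metis Re_herm uminus_complex.sel(1))

text \<open>Moving a vector past a product of two vectors costs two contractions; both the double
  commutator of vectors and the action of the spin connection on vectors reduce to this.\<close>

lemma gamma_commute_pair:
  "\<gamma> a *v (\<gamma> b *v (\<gamma> c *v u)) = \<gamma> c *v (\<gamma> a *v (\<gamma> b *v u))
     + (if a = c then 2 else 0) *\<^sub>R (\<gamma> b *v u) - (if b = c then 2 else 0) *\<^sub>R (\<gamma> a *v u)"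
  unfolding gamma_anticomm[of b c u] mv_linear_simps gamma_anticomm[of a c "\<gamma> b *v u"]
  by simp

text \<open>Reordering both products by \<open>gamma_commute_pair\<close> cancels the cubic terms of \<open>[ZY - YZ, X]\<close>, so this
  commutator is again a vector. For Killing spinors it plays the part of the curvature of the unit sphere.\<close>

lemma gamma_double_commutator:
  "\<gamma> b *v (\<gamma> a *v (\<gamma> d *v u)) - \<gamma> a *v (\<gamma> b *v (\<gamma> d *v u))
     - \<gamma> d *v (\<gamma> b *v (\<gamma> a *v u) - \<gamma> a *v (\<gamma> b *v u))
   = (if b = d then 4 else 0) *\<^sub>R (\<gamma> a *v u) - (if a = d then 4 else 0) *\<^sub>R (\<gamma> b *v u)"
  unfolding gamma_commute_pair[of b a d u] gamma_commute_pair[of a b d u] mv_linear_simps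
  by (auto simp: algebra_simps scaleR_add_left[symmetric])

lemma cliff_skew: "(cliff \<gamma> x *v u) \<bullet> w = - (u \<bullet> (cliff \<gamma> x *v w))"
  by (simp add: cliff_apply inner_sum_left inner_sum_right gamma_skew sum_negf)

lemma cliff_square: "cliff \<gamma> x *v (cliff \<gamma> x *v u) = - (norm x)\<^sup>2 *\<^sub>R u"
proof -
  let ?S = "\<Sum>a\<in>UNIV. \<Sum>b\<in>UNIV. (x $ a * x $ b) *\<^sub>R (\<gamma> a *v (\<gamma> b *v u))"
  have S: "cliff \<gamma> x *v (cliff \<gamma> x *v u) = ?S"
    by (simp add: cliff_apply mv_linear_simps scaleR_sum_right)
      (rule trans[OF sum.swap], simp add: mult.commute)
  \<comment> \<open>Adding the sum to its own transpose leaves anticommutators, which vanish off the diagonal.\<close>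
  have "?S = (\<Sum>a\<in>UNIV. \<Sum>b\<in>UNIV. (x $ a * x $ b) *\<^sub>R (\<gamma> b *v (\<gamma> a *v u)))"
    by (rule trans[OF sum.swap]) (simp add: mult.commute)
  then have "?S + ?S = (\<Sum>a\<in>UNIV. \<Sum>b\<in>UNIV.
      (x $ a * x $ b) *\<^sub>R (\<gamma> a *v (\<gamma> b *v u) + \<gamma> b *v (\<gamma> a *v u)))"
    by (simp add: sum.distrib scaleR_add_right)
  also have "\<dots> = (\<Sum>a\<in>UNIV. \<Sum>b\<in>UNIV. if a = b then (- 2 * (x $ a * x $ a)) *\<^sub>R u else 0)"
  proof (intro sum.cong refl)
    show "(x $ a * x $ b) *\<^sub>R (\<gamma> a *v (\<gamma> b *v u) + \<gamma> b *v (\<gamma> a *v u))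
        = (if a = b then (- 2 * (x $ a * x $ a)) *\<^sub>R u else 0)" for a b
      unfolding gamma_anticomm[of a b u] by simp
  qed
  also have "\<dots> = (- 2 * (norm x)\<^sup>2) *\<^sub>R u"
    by (simp add: power2_norm_eq_inner inner_vec_def sum_distrib_left scaleR_sum_left sum_negf)
  finally have "2 *\<^sub>R ?S = 2 *\<^sub>R (- (norm x)\<^sup>2 *\<^sub>R u)"
    by (simp add: scaleR_2)
  then show ?thesis
    using S by (metis scaleR_cancel_left zero_neq_numeral)
qed

text \<open>Unit vectors act by skew operators of square \<open>-1\<close>, hence orthogonally.\<close>

lemma spin_group_isometry:
  assumes "s \<in> spin_group \<gamma>"
  shows "(s *v u) \<bullet> (s *v w) = u \<bullet> w"
proof -
  have unit: "(cliff \<gamma> x *v u) \<bullet> (cliff \<gamma> x *v w) = u \<bullet> w" if "norm x = 1" for x u w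
    using that by (simp add: cliff_skew cliff_square)
  obtain xs where "\<forall>x\<in>set xs. norm x = 1" "s = foldr (\<lambda>x t. cliff \<gamma> x ** t) xs (mat 1)"
    using assms by (auto simp: spin_group_def)
  then show ?thesis
    by (induction xs arbitrary: s) (auto simp: matrix_vector_mul_assoc[symmetric] unit)
qed

text \<open>The zeroth order term of the spin connection in a frame whose connection coefficients in a
  given direction are \<open>\<omega>\<close>.\<close>

definition conn_term :: "('n \<Rightarrow> 'n \<Rightarrow> real) \<Rightarrow> complex ^ 's \<Rightarrow> complex ^ 's" where
  "conn_term \<omega> u = (1/4) *\<^sub>R (\<Sum>a\<in>UNIV. \<Sum>b\<in>UNIV. \<omega> a b *\<^sub>R (\<gamma> a *v (\<gamma> b *v u)))"

lemma conn_term_linear: "linear (conn_term \<omega>)"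
  by (rule linearI) (simp_all add: conn_term_def mv_linear_simps scaleR_add_right sum.distrib
      scaleR_sum_right mult.commute mult.left_commute)

lemma conn_term_skew:
  assumes "\<And>a b. \<omega> a b = - \<omega> b a"
  shows "conn_term \<omega> u \<bullet> w = - (u \<bullet> conn_term \<omega> w)"
proof -
  have "(\<Sum>a\<in>UNIV. \<Sum>b\<in>UNIV. \<omega> a b * ((\<gamma> a *v (\<gamma> b *v u)) \<bullet> w))
      = (\<Sum>a\<in>UNIV. \<Sum>b\<in>UNIV. \<omega> a b * (u \<bullet> (\<gamma> b *v (\<gamma> a *v w))))"
    by (simp add: gamma_skew)
  also have "\<dots> = (\<Sum>b\<in>UNIV. \<Sum>a\<in>UNIV. \<omega> a b * (u \<bullet> (\<gamma> b *v (\<gamma> a *v w))))"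
    by (rule sum.swap)
  also have "\<dots> = - (\<Sum>a\<in>UNIV. \<Sum>b\<in>UNIV. \<omega> a b * (u \<bullet> (\<gamma> a *v (\<gamma> b *v w))))"
    by (subst assms) (simp add: sum_negf)
  finally show ?thesis
    by (simp add: conn_term_def inner_sum_left inner_sum_right)
qed

text \<open>This is the compatibility of the spin connection with Clifford multiplication: commuting with
  the connection term turns a frame vector into its covariant derivative.\<close>

lemma conn_term_gamma:
  assumes "\<And>a b. \<omega> a b = - \<omega> b a"
  shows "conn_term \<omega> (\<gamma> c *v u) - \<gamma> c *v conn_term \<omega> u = (\<Sum>b\<in>UNIV. \<omega> c b *\<^sub>R (\<gamma> b *v u))"
proof -
  have "conn_term \<omega> (\<gamma> c *v u) - \<gamma> c *v conn_term \<omega> u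
      = (1/4) *\<^sub>R (\<Sum>a\<in>UNIV. \<Sum>b\<in>UNIV. \<omega> a b *\<^sub>R
          (\<gamma> a *v (\<gamma> b *v (\<gamma> c *v u)) - \<gamma> c *v (\<gamma> a *v (\<gamma> b *v u))))"
    by (simp add: conn_term_def mv_linear_simps scaleR_diff_right sum_subtractf)
  also have "\<dots> = (1/4) *\<^sub>R (\<Sum>a\<in>UNIV. \<Sum>b\<in>UNIV. (if a = c then (2 * \<omega> a b) *\<^sub>R (\<gamma> b *v u) else 0)
      - (if b = c then (2 * \<omega> a b) *\<^sub>R (\<gamma> a *v u) else 0))"
    by (intro arg_cong[where f="scaleR (1/4)"] sum.cong refl)
      (auto simp: gamma_commute_pair[of _ _ c] algebra_simps)
  also have "(\<Sum>a\<in>UNIV. \<Sum>b\<in>UNIV. (if a = c then (2 * \<omega> a b) *\<^sub>R (\<gamma> b *v u) else 0)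
      - (if b = c then (2 * \<omega> a b) *\<^sub>R (\<gamma> a *v u) else 0))
     = (\<Sum>b\<in>UNIV. (2 * \<omega> c b) *\<^sub>R (\<gamma> b *v u)) - (\<Sum>a\<in>UNIV. (2 * \<omega> a c) *\<^sub>R (\<gamma> a *v u))"
    by (simp only: sum_subtractf) (subst sum.swap, simp)
  also have "\<dots> = (\<Sum>b\<in>UNIV. (4 * \<omega> c b) *\<^sub>R (\<gamma> b *v u))"
    using assms[of _ c] by (simp add: sum_subtractf[symmetric] algebra_simps scaleR_add_left[symmetric])
  finally show ?thesis
    by (simp add: scaleR_sum_right)
qed

lemma conn_term_gamma_pair:
  assumes "\<And>a b. \<omega> a b = - \<omega> b a"
  shows "conn_term \<omega> (\<gamma> b *v (\<gamma> a *v u)) - \<gamma> b *v (\<gamma> a *v conn_term \<omega> u)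
    = (\<Sum>c\<in>UNIV. \<omega> b c *\<^sub>R (\<gamma> c *v (\<gamma> a *v u)) + \<omega> a c *\<^sub>R (\<gamma> b *v (\<gamma> c *v u)))"
proof -
  have "conn_term \<omega> (\<gamma> b *v (\<gamma> a *v u)) - \<gamma> b *v (\<gamma> a *v conn_term \<omega> u)
    = (conn_term \<omega> (\<gamma> b *v (\<gamma> a *v u)) - \<gamma> b *v conn_term \<omega> (\<gamma> a *v u))
      + \<gamma> b *v (conn_term \<omega> (\<gamma> a *v u) - \<gamma> a *v conn_term \<omega> u)"
    by (simp add: mv_linear_simps)
  then show ?thesis
    by (simp add: conn_term_gamma[OF assms] mv_linear_simps sum.distrib)
qed

end

section \<open>Differentiating spinors\<close>

context smooth_manifold
begin

lemma smooth_near_components: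
  fixes F :: "'m \<Rightarrow> complex ^ 's"
  assumes "smooth_near A p F"
  shows "smooth_near A p (\<lambda>q. Re (F q $ k))" "smooth_near A p (\<lambda>q. Im (F q $ k))"
  using smooth_near_bounded_linear[OF bounded_linear_compose[OF bounded_linear_Re bounded_linear_vec_nth] assms]
    smooth_near_bounded_linear[OF bounded_linear_compose[OF bounded_linear_Im bounded_linear_vec_nth] assms]
  by auto

lemma tvec_apply_inner:
  fixes F G :: "'m \<Rightarrow> complex ^ 's"
  assumes v: "v \<in> tangent_space A p" and F: "smooth_near A p F" and G: "smooth_near A p G"
  shows "v (\<lambda>q. F q \<bullet> G q) = tvec_apply v F \<bullet> G p + F p \<bullet> tvec_apply v G"
proof -
  note sm = smooth_near_components[OF F] smooth_near_components[OF G]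
  have "v (\<lambda>q. F q \<bullet> G q)
      = v (\<lambda>q. \<Sum>k\<in>UNIV. Re (F q $ k) * Re (G q $ k) + Im (F q $ k) * Im (G q $ k))"
    by (simp add: inner_vec_def inner_complex_def)
  also have "\<dots> = (\<Sum>k\<in>UNIV. v (\<lambda>q. Re (F q $ k) * Re (G q $ k) + Im (F q $ k) * Im (G q $ k)))"
    by (rule tangent_sum[OF v]) (intro smooth_near_add smooth_near_mult sm)
  also have "\<dots> = (\<Sum>k\<in>UNIV. v (\<lambda>q. Re (F q $ k)) * Re (G p $ k) + Re (F p $ k) * v (\<lambda>q. Re (G q $ k))
      + (v (\<lambda>q. Im (F q $ k)) * Im (G p $ k) + Im (F p $ k) * v (\<lambda>q. Im (G q $ k))))"
    by (simp only: tangent_add[OF v smooth_near_mult[OF sm(1,3)] smooth_near_mult[OF sm(2,4)]]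
        tangent_mult[OF v sm(1,3)] tangent_mult[OF v sm(2,4)])
  also have "\<dots> = tvec_apply v F \<bullet> G p + F p \<bullet> tvec_apply v G"
    by (simp add: inner_vec_def inner_complex_def tvec_apply_def sum.distrib[symmetric] algebra_simps)
  finally show ?thesis .
qed

lemma tvec_apply_matrix:
  fixes F :: "'m \<Rightarrow> complex ^ 's"
  assumes v: "v \<in> tangent_space A p" and F: "smooth_near A p F"
  shows "tvec_apply v (\<lambda>q. B *v F q) = B *v tvec_apply v F"
proof -
  note sm = smooth_near_components[OF F]
  have lin: "v (\<lambda>q. \<Sum>l\<in>UNIV. x l * Re (F q $ l) + y l * Im (F q $ l))
      = (\<Sum>l\<in>UNIV. x l * v (\<lambda>q. Re (F q $ l)) + y l * v (\<lambda>q. Im (F q $ l)))" for x y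
  proof -
    have "v (\<lambda>q. \<Sum>l\<in>UNIV. x l * Re (F q $ l) + y l * Im (F q $ l))
        = (\<Sum>l\<in>UNIV. v (\<lambda>q. x l * Re (F q $ l) + y l * Im (F q $ l)))"
      by (rule tangent_sum[OF v]) (intro smooth_near_add smooth_near_mult smooth_near_const sm)
    also have "\<dots> = (\<Sum>l\<in>UNIV. x l * v (\<lambda>q. Re (F q $ l)) + y l * v (\<lambda>q. Im (F q $ l)))"
      by (simp only: tangent_add[OF v smooth_near_mult[OF smooth_near_const sm(1)]
            smooth_near_mult[OF smooth_near_const sm(2)]] tangent_scale[OF v sm(1)]
          tangent_scale[OF v sm(2)])
    finally show ?thesis .
  qed
  have "Re ((B *v F q) $ k) = (\<Sum>l\<in>UNIV. Re (B $ k $ l) * Re (F q $ l) + (- Im (B $ k $ l)) * Im (F q $ l))"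
    "Im ((B *v F q) $ k) = (\<Sum>l\<in>UNIV. Im (B $ k $ l) * Re (F q $ l) + Re (B $ k $ l) * Im (F q $ l))" for q k
    by (simp_all add: matrix_vector_mult_def algebra_simps)
  then show ?thesis
    unfolding tvec_apply_def
    by (simp only: lin) (simp add: vec_eq_iff complex_eq_iff matrix_vector_mult_def algebra_simps)
qed

end

section \<open>The spinor bundle in a local frame\<close>

locale spin_manifold = levi_civita_manifold M D
  for M :: "('m::{t2_space, second_countable_topology}, 'n::finite, 's::finite, 'i) spin_riem"
    and D :: "'m conn" +
  assumes gam_rep: "spin_rep (gam M)" and spin: "spin_structure M"

sublocale spin_manifold \<subseteq> clifford_rep "gam M"
  using gam_rep by unfold_locales

context spin_manifold
begin

lemma patch_open: "open (patch M i)"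
  using spin by (simp add: spin_structure_def)

lemma patch_cover: "\<exists>i. p \<in> patch M i"
  using spin by (auto simp: spin_structure_def)

lemma frame_field: "vector_field (atl M) (patch M i) (frm M i a)"
  using spin by (simp add: spin_structure_def)

lemma frame_near: "p \<in> patch M i \<Longrightarrow> vector_field_near (atl M) p (frm M i a)"
  using vector_field_nearI[OF frame_field] .

lemma frame_basis: "p \<in> patch M i \<Longrightarrow> orthonormal_basis M p (\<lambda>a. frm M i a p)"
  using spin by (simp add: spin_structure_def)

lemma frame_tangent: "p \<in> patch M i \<Longrightarrow> frm M i a p \<in> tspace M p"
  using basis_tangent[OF frame_basis] .

lemma eventually_patch: "p \<in> patch M i \<Longrightarrow> eventually (\<lambda>q. q \<in> patch M i) (nhds p)"
  using patch_open by (simp add: eventually_nhds_in_open)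

text \<open>Extend by constant coefficients with respect to a local frame.\<close>

lemma tangent_vector_extends:
  assumes "v \<in> tspace M p"
  shows "\<exists>X. vector_field_near (atl M) p X \<and> X p = v"
proof -
  obtain i where p: "p \<in> patch M i" using patch_cover by blast
  have "vector_field (atl M) (patch M i) (\<lambda>q f. \<Sum>a\<in>UNIV. met M p v (frm M i a p) * frm M i a q f)"
    by (rule vector_field_sum[OF patch_open frame_field smooth_near_const])
  from vector_field_nearI[OF this p] basis_expand[OF frame_basis[OF p] assms, symmetric]
  show ?thesis by (intro exI conjI)
qed

definition coords :: "'i \<Rightarrow> 'm \<Rightarrow> 'm tvec \<Rightarrow> real ^ 'n" where
  "coords i p v = (\<chi> a. met M p v (frm M i a p))"

lemma transition_covers:
  assumes "p \<in> patch M i" "p \<in> patch M j"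
  shows "\<exists>B. spin_covers (gam M) (tr M i j p) B \<and>
    (\<forall>b. frm M j b p = (\<lambda>f. \<Sum>a\<in>UNIV. B $ a $ b * frm M i a p f))"
proof -
  have "\<forall>i j. \<forall>p\<in>patch M i \<inter> patch M j. \<exists>B. spin_covers (gam M) (tr M i j p) B \<and>
      (\<forall>b. frm M j b p = (\<lambda>f. \<Sum>a\<in>UNIV. B $ a $ b * frm M i a p f))"
    using spin unfolding spin_structure_def by (elim conjE)
  from this[rule_format, OF IntI, OF assms] show ?thesis by simp
qed

text \<open>Clifford multiplication is compatible with a change of trivialisation because the covering
  \<open>Spin(n) \<rightarrow> SO(n)\<close> sends the transition function to the change of frame.\<close>

lemma transition_cliff:
  assumes i: "p \<in> patch M i" and j: "p \<in> patch M j" and v: "v \<in> tspace M p"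
  shows "tr M i j p *v (cliff (gam M) (coords j p v) *v u)
    = cliff (gam M) (coords i p v) *v (tr M i j p *v u)"
proof -
  obtain B where B: "spin_covers (gam M) (tr M i j p) B"
    "\<And>b. frm M j b p = (\<lambda>f. \<Sum>a\<in>UNIV. B $ a $ b * frm M i a p f)"
    using transition_covers[OF i j] by blast
  have "met M p v (frm M i a p) = (\<Sum>b\<in>UNIV. B $ a $ b * met M p v (frm M j b p))" for a
  proof -
    have "met M p (frm M i a p) (frm M j b p) = B $ a $ b" for b
      unfolding B(2) using i by (simp add: met_sum_right frame_tangent basis_orthonormal[OF frame_basis]
          if_distrib cong: if_cong)
    then show ?thesis
      using met_expand[OF frame_basis[OF j] frame_tangent[OF i] v, of a]
        met_sym[OF v frame_tangent[OF i]] by (simp add: mult.commute)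
  qed
  then have "coords i p v = B *v coords j p v"
    by (simp add: coords_def vec_eq_iff matrix_vector_mult_def)
  then show ?thesis
    using B(1) by (simp add: spin_covers_def matrix_vector_mul_assoc)
qed

text \<open>The Hermitian metric is defined through an arbitrarily chosen patch around \<open>p\<close>. Since the spin group
  acts isometrically and compatibly with Clifford multiplication, any other patch may be used, in
  particular one that is fixed while \<open>p\<close> varies, as differentiation requires.\<close>

lemma spinor_oneform_local:
  assumes i: "p \<in> patch M i" and v: "v \<in> tspace M p"
    and \<psi>: "\<psi>1 p \<in> spinor_space M p" "\<psi>2 p \<in> spinor_space M p"
  shows "spinor_oneform M \<psi>1 \<psi>2 p v = \<psi>1 p i \<bullet> (cliff (gam M) (coords i p v) *v \<psi>2 p i)"
proof -
  define j where "j = (SOME j. p \<in> patch M j)"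
  have j: "p \<in> patch M j" unfolding j_def using patch_cover by (rule someI_ex)
  have "tr M j i p \<in> spin_group (gam M)"
    using transition_covers[OF j i] by (auto simp: spin_covers_def)
  moreover have "\<psi>1 p j = tr M j i p *v \<psi>1 p i" "\<psi>2 p j = tr M j i p *v \<psi>2 p i"
    using \<psi> i j unfolding spinor_space_def by blast+
  ultimately have "\<psi>1 p j \<bullet> (cliff (gam M) (coords j p v) *v \<psi>2 p j)
      = \<psi>1 p i \<bullet> (cliff (gam M) (coords i p v) *v \<psi>2 p i)"
    by (simp add: transition_cliff[OF j i v, symmetric] spin_group_isometry)
  then show ?thesis
    using j by (simp add: spinor_oneform_def spinor_herm_def clifford_mult_def coords_def Re_herm
        Let_def j_def[symmetric])
qed

definition conn_coeff :: "'i \<Rightarrow> 'm \<Rightarrow> 'm tvec \<Rightarrow> 'n \<Rightarrow> 'n \<Rightarrow> real" where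
  "conn_coeff i p v a b = met M p (D (frm M i a) p v) (frm M i b p)"

lemma conn_coeff_skew:
  assumes p: "p \<in> patch M i" and v: "v \<in> tspace M p"
  shows "conn_coeff i p v a b = - conn_coeff i p v b a"
proof -
  have "eventually (\<lambda>q. met M q (frm M i a q) (frm M i b q) = (if a = b then 1 else 0)) (nhds p)"
    using eventually_patch[OF p] by eventually_elim (rule basis_orthonormal[OF frame_basis])
  then show ?thesis
    using tangent_locally_const[OF v] D_metric[OF frame_near[OF p] frame_near[OF p] v, of a b]
      met_sym[OF frame_tangent[OF p] D_tangent[OF frame_near[OF p] v], of a b]
    by (simp add: conn_coeff_def)
qed

text \<open>Frame components of a covariant derivative, obtained from metric compatibility with the frame
  vector as second argument instead of from an expansion of \<open>Y\<close>.\<close>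

lemma D_component:
  assumes p: "p \<in> patch M i" and v: "v \<in> tspace M p" and Y: "vector_field_near (atl M) p Y"
  shows "met M p (D Y p v) (frm M i b p) = v (\<lambda>q. met M q (Y q) (frm M i b q))
    - (\<Sum>c\<in>UNIV. conn_coeff i p v b c * met M p (Y p) (frm M i c p))"
  using D_metric[OF Y frame_near[OF p] v, of b]
    met_expand[OF frame_basis[OF p] vector_field_near_tangent[OF Y] D_tangent[OF frame_near[OF p] v]]
  by (simp add: conn_coeff_def)

end

section \<open>The 1-form of a pair of Killing spinors\<close>

locale killing_pair = spin_manifold M D
  for M :: "('m::{t2_space, second_countable_topology}, 'n::finite, 's::finite, 'i) spin_riem"
    and D :: "'m conn" +
  fixes \<psi>1 \<psi>2 :: "('m, 's, 'i) spinor_field" and \<kappa> :: real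
  assumes kappa_sq: "\<kappa> * \<kappa> = 1/4"
    and killing: "killing_spinor M D (of_real \<kappa>) \<psi>1" "killing_spinor M D (of_real \<kappa>) \<psi>2"
begin

lemma tvec_apply_killing:
  assumes K: "killing_spinor M D (of_real \<kappa>) \<psi>" and p: "p \<in> patch M i" and v: "v \<in> tspace M p"
  shows "tvec_apply v (\<lambda>q. \<psi> q i) = \<kappa> *\<^sub>R (cliff (gam M) (coords i p v) *v \<psi> p i)
    - conn_term (conn_coeff i p v) (\<psi> p i)"
proof -
  have "spin_conn M D \<psi> p v i = of_real \<kappa> *s clifford_mult M p v (\<psi> p) i"
    using K v by (simp add: killing_spinor_def)
  moreover have "of_real \<kappa> *s u = \<kappa> *\<^sub>R u" for u :: "complex ^ 's"
    by (simp add: vec_eq_iff scaleR_conv_of_real[where 'a=complex])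
  ultimately show ?thesis
    using p by (simp add: spin_conn_def clifford_mult_def conn_term_def conn_coeff_def coords_def
        eq_diff_eq)
qed

lemma smooth_near_spinor:
  assumes "killing_spinor M D (of_real \<kappa>) \<psi>" "p \<in> patch M i"
  shows "smooth_near (atl M) p (\<lambda>q. \<psi> q i)"
  using assms by (auto simp: killing_spinor_def spinor_section_def smooth_near_def)

text \<open>The frame components of \<open>\<eta>\<close> and \<open>\<nabla>\<eta>\<close> have the form \<open>Re\<langle>\<psi>\<^sub>1, A \<psi>\<^sub>2\<rangle>\<close> with \<open>A\<close> a constant element of
  the Clifford algebra. Since the connection term and Clifford multiplication by vectors are skew, a
  derivative replaces \<open>A\<close> by its commutators with them.\<close>

lemma derivative_bilinear:
  assumes p: "p \<in> patch M i" and v: "v \<in> tspace M p"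
  defines "X \<equiv> cliff (gam M) (coords i p v)" and "\<Gamma> \<equiv> conn_term (conn_coeff i p v)"
  shows "v (\<lambda>q. \<psi>1 q i \<bullet> (A *v \<psi>2 q i))
    = \<psi>1 p i \<bullet> (\<Gamma> (A *v \<psi>2 p i) - A *v \<Gamma> (\<psi>2 p i))
      + \<kappa> * (\<psi>1 p i \<bullet> (A *v (X *v \<psi>2 p i) - X *v (A *v \<psi>2 p i)))"
proof -
  note sm = smooth_near_spinor[OF killing(1) p] smooth_near_spinor[OF killing(2) p]
  have skew: "\<Gamma> u \<bullet> w = - (u \<bullet> \<Gamma> w)" "(X *v u) \<bullet> w = - (u \<bullet> (X *v w))" for u w
    unfolding \<Gamma>_def X_def
    by (rule conn_term_skew[of "conn_coeff i p v", OF conn_coeff_skew[OF p v]]) (rule cliff_skew)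
  have "v (\<lambda>q. \<psi>1 q i \<bullet> (A *v \<psi>2 q i)) = tvec_apply v (\<lambda>q. \<psi>1 q i) \<bullet> (A *v \<psi>2 p i)
      + \<psi>1 p i \<bullet> (A *v tvec_apply v (\<lambda>q. \<psi>2 q i))"
    using tvec_apply_inner[OF v sm(1) smooth_near_bounded_linear[OF bounded_linear_matrix_vector sm(2)], of A]
      tvec_apply_matrix[OF v sm(2), of A] by simp
  also have "\<dots> = (\<kappa> *\<^sub>R (X *v \<psi>1 p i) - \<Gamma> (\<psi>1 p i)) \<bullet> (A *v \<psi>2 p i)
      + \<psi>1 p i \<bullet> (A *v (\<kappa> *\<^sub>R (X *v \<psi>2 p i) - \<Gamma> (\<psi>2 p i)))"
    unfolding tvec_apply_killing[OF killing(1) p v] tvec_apply_killing[OF killing(2) p v]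
      X_def \<Gamma>_def ..
  also have "\<dots> = \<psi>1 p i \<bullet> (\<Gamma> (A *v \<psi>2 p i) - A *v \<Gamma> (\<psi>2 p i))
      + \<kappa> * (\<psi>1 p i \<bullet> (A *v (X *v \<psi>2 p i) - X *v (A *v \<psi>2 p i)))"
    by (simp add: mv_linear_simps inner_diff_left inner_diff_right skew algebra_simps)
  finally show ?thesis .
qed

definition eta_coeff :: "'i \<Rightarrow> 'n \<Rightarrow> 'm \<Rightarrow> real" where
  "eta_coeff i a p = \<psi>1 p i \<bullet> (gam M a *v \<psi>2 p i)"

text \<open>The component \<open>(\<nabla>\<^sub>a \<eta>)(e\<^sub>b) = \<kappa> Re\<langle>\<psi>\<^sub>1, (e\<^sub>b e\<^sub>a - e\<^sub>a e\<^sub>b) \<psi>\<^sub>2\<rangle>\<close> of the covariant derivative of the 1-form \<open>\<eta>\<close>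
  of the two spinors, where \<open>\<nabla>\<^sub>a\<close> is differentiation along \<open>e\<^sub>a\<close>.\<close>

definition deta_coeff :: "'i \<Rightarrow> 'n \<Rightarrow> 'n \<Rightarrow> 'm \<Rightarrow> real" where
  "deta_coeff i a b p = \<kappa> * (\<psi>1 p i \<bullet> ((gam M b ** gam M a - gam M a ** gam M b) *v \<psi>2 p i))"

lemma deta_coeff_skew: "deta_coeff i a b p = - deta_coeff i b a p"
  by (simp add: deta_coeff_def matrix_vector_mult_diff_rdistrib inner_diff_right algebra_simps)

lemma smooth_near_eta_coeff: "p \<in> patch M i \<Longrightarrow> smooth_near (atl M) p (eta_coeff i a)"
  unfolding eta_coeff_def[abs_def]
  by (intro smooth_near_inner smooth_near_bounded_linear[OF bounded_linear_matrix_vector]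
      smooth_near_spinor killing)

lemma smooth_near_deta_coeff: "p \<in> patch M i \<Longrightarrow> smooth_near (atl M) p (deta_coeff i a b)"
  unfolding deta_coeff_def[abs_def]
  by (intro smooth_near_mult smooth_near_const smooth_near_inner
      smooth_near_bounded_linear[OF bounded_linear_matrix_vector] smooth_near_spinor killing)

text \<open>Here \<open>A = e\<^sub>a\<close>: the commutator with the connection term rotates the frame index, and the commutator
  with Clifford multiplication by \<open>v\<close> is the covariant derivative of \<open>\<eta>\<close>.\<close>

lemma derivative_eta_coeff:
  assumes p: "p \<in> patch M i" and v: "v \<in> tspace M p"
  shows "v (eta_coeff i a) = (\<Sum>b\<in>UNIV. conn_coeff i p v a b * eta_coeff i b p)
    + (\<Sum>d\<in>UNIV. coords i p v $ d * deta_coeff i d a p)"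
proof -
  have "v (eta_coeff i a) = (\<Sum>b\<in>UNIV. conn_coeff i p v a b * eta_coeff i b p)
    + \<kappa> * (\<psi>1 p i \<bullet> (gam M a *v (cliff (gam M) (coords i p v) *v \<psi>2 p i)
      - cliff (gam M) (coords i p v) *v (gam M a *v \<psi>2 p i)))"
    unfolding eta_coeff_def[abs_def] derivative_bilinear[OF p v]
      conn_term_gamma[OF conn_coeff_skew[OF p v]]
    by (simp add: inner_sum_right)
  then show ?thesis
    by (simp add: cliff_apply mv_linear_simps deta_coeff_def sum_subtractf[symmetric]
        matrix_vector_mult_diff_rdistrib matrix_vector_mul_assoc[symmetric] inner_sum_right
        inner_diff_right sum_distrib_left algebra_simps)
qed

text \<open>Here \<open>A = e\<^sub>b e\<^sub>a - e\<^sub>a e\<^sub>b\<close>. Besides the rotation of both indices there remains \<open>\<kappa>\<^sup>2 = 1/4\<close> times the double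
  commutator of vectors, whose factor 4 it cancels exactly; this is where the normalisation of the
  Killing number enters.\<close>

lemma derivative_deta_coeff:
  assumes p: "p \<in> patch M i" and v: "v \<in> tspace M p"
  shows "v (deta_coeff i a b) = (\<Sum>c\<in>UNIV. conn_coeff i p v a c * deta_coeff i c b p
        + conn_coeff i p v b c * deta_coeff i a c p)
    + coords i p v $ b * eta_coeff i a p - coords i p v $ a * eta_coeff i b p"
proof -
  let ?A = "gam M b ** gam M a - gam M a ** gam M b"
  let ?\<Gamma> = "conn_term (conn_coeff i p v)" and ?x = "coords i p v"
  let ?X = "cliff (gam M) ?x" and ?u = "\<psi>2 p i"
  have A: "?A *v u = gam M b *v (gam M a *v u) - gam M a *v (gam M b *v u)" for u
    by (simp add: matrix_vector_mult_diff_rdistrib matrix_vector_mul_assoc)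
  have sm: "smooth_near (atl M) p (\<lambda>q. \<psi>1 q i \<bullet> (?A *v \<psi>2 q i))"
    by (intro smooth_near_inner smooth_near_bounded_linear[OF bounded_linear_matrix_vector]
      smooth_near_spinor killing p)
  have "v (deta_coeff i a b) = \<kappa> * (\<psi>1 p i \<bullet> (?\<Gamma> (?A *v ?u) - ?A *v ?\<Gamma> ?u))
      + \<kappa> * \<kappa> * (\<psi>1 p i \<bullet> (?A *v (?X *v ?u) - ?X *v (?A *v ?u)))"
    unfolding deta_coeff_def[abs_def] tangent_scale[OF v sm] derivative_bilinear[OF p v]
    by (simp add: algebra_simps)
  moreover have "?\<Gamma> (?A *v ?u) - ?A *v ?\<Gamma> ?u = (\<Sum>c\<in>UNIV.
      conn_coeff i p v a c *\<^sub>R ((gam M b ** gam M c - gam M c ** gam M b) *v ?u)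
      + conn_coeff i p v b c *\<^sub>R ((gam M c ** gam M a - gam M a ** gam M c) *v ?u))"
  proof -
    have "?\<Gamma> (?A *v ?u) - ?A *v ?\<Gamma> ?u
      = (?\<Gamma> (gam M b *v (gam M a *v ?u)) - gam M b *v (gam M a *v ?\<Gamma> ?u))
        - (?\<Gamma> (gam M a *v (gam M b *v ?u)) - gam M a *v (gam M b *v ?\<Gamma> ?u))"
      unfolding A linear_diff[OF conn_term_linear] by simp
    also have "\<dots> = (\<Sum>c\<in>UNIV.
      conn_coeff i p v a c *\<^sub>R ((gam M b ** gam M c - gam M c ** gam M b) *v ?u)
      + conn_coeff i p v b c *\<^sub>R ((gam M c ** gam M a - gam M a ** gam M c) *v ?u))"
      unfolding conn_term_gamma_pair[OF conn_coeff_skew[OF p v]] sum_subtractf[symmetric]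
      by (intro sum.cong refl) (simp add: matrix_vector_mult_diff_rdistrib
          matrix_vector_mul_assoc[symmetric] algebra_simps)
    finally show ?thesis .
  qed
  moreover have "?A *v (?X *v ?u) - ?X *v (?A *v ?u)
      = 4 *\<^sub>R ((?x $ b) *\<^sub>R (gam M a *v ?u) - (?x $ a) *\<^sub>R (gam M b *v ?u))"
  proof -
    have "?A *v (?X *v ?u) - ?X *v (?A *v ?u) = (\<Sum>d\<in>UNIV. (?x $ d) *\<^sub>R
        (?A *v (gam M d *v ?u) - gam M d *v (?A *v ?u)))"
      by (simp add: cliff_apply mv_linear_simps sum_subtractf scaleR_diff_right)
    also have "\<dots> = (\<Sum>d\<in>UNIV. (if b = d then (4 * ?x $ d) *\<^sub>R (gam M a *v ?u) else 0)
        - (if a = d then (4 * ?x $ d) *\<^sub>R (gam M b *v ?u) else 0))"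
      unfolding A gamma_double_commutator by (intro sum.cong refl) (simp add: algebra_simps)
    finally show ?thesis
      by (simp add: sum_subtractf algebra_simps)
  qed
  ultimately have "v (deta_coeff i a b) = \<kappa> * (\<psi>1 p i \<bullet> (\<Sum>c\<in>UNIV.
      conn_coeff i p v a c *\<^sub>R ((gam M b ** gam M c - gam M c ** gam M b) *v ?u)
      + conn_coeff i p v b c *\<^sub>R ((gam M c ** gam M a - gam M a ** gam M c) *v ?u)))
    + 1/4 * (\<psi>1 p i \<bullet> (4 *\<^sub>R ((?x $ b) *\<^sub>R (gam M a *v ?u) - (?x $ a) *\<^sub>R (gam M b *v ?u))))"
    by (simp only: kappa_sq)
  then show ?thesis
    by (simp add: deta_coeff_def eta_coeff_def inner_sum_right inner_add_right inner_diff_right sum_distrib_left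
        algebra_simps)
qed

section \<open>The dual vector field and its second derivative\<close>

abbreviation \<xi> :: "'m vfield" where "\<xi> \<equiv> spinor_vfield M \<psi>1 \<psi>2"

text \<open>In a local frame \<open>\<xi>\<close> has the smooth components \<open>\<eta>(e\<^sub>a)\<close>; this is why the pointwise dual of \<open>\<eta>\<close> is a smooth
  vector field.\<close>

lemma xi_local:
  assumes p: "p \<in> patch M i"
  shows "\<xi> p = (\<lambda>f. \<Sum>a\<in>UNIV. eta_coeff i a p * frm M i a p f)"
  unfolding spinor_vfield_def
proof (rule sharp_eqI)
  show "(\<lambda>f. \<Sum>a\<in>UNIV. eta_coeff i a p * frm M i a p f) \<in> tspace M p"
    by (intro tangent_space_sum frame_tangent p)
  fix w assume w: "w \<in> tspace M p"
  have sp: "\<psi>1 p \<in> spinor_space M p" "\<psi>2 p \<in> spinor_space M p"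
    using killing by (auto simp: killing_spinor_def spinor_section_def)
  have "met M p (\<lambda>f. \<Sum>a\<in>UNIV. eta_coeff i a p * frm M i a p f) w
      = (\<Sum>a\<in>UNIV. eta_coeff i a p * met M p (frm M i a p) w)"
    by (rule met_sum[OF w frame_tangent[OF p]])
  then show "met M p (\<lambda>f. \<Sum>a\<in>UNIV. eta_coeff i a p * frm M i a p f) w = spinor_oneform M \<psi>1 \<psi>2 p w"
    by (simp add: spinor_oneform_local[of p i w \<psi>1 \<psi>2, OF p w sp] cliff_apply inner_sum_right coords_def
        eta_coeff_def met_sym[OF w frame_tangent[OF p]] mult.commute)
qed

lemma xi_vector_field: "vector_field (atl M) UNIV \<xi>"
proof -
  have "vector_field_near (atl M) p \<xi>" for p
  proof -
    obtain i where p: "p \<in> patch M i" using patch_cover by blast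
    have "eventually (\<lambda>q. (\<lambda>f. \<Sum>a\<in>UNIV. eta_coeff i a q * frm M i a q f) = \<xi> q) (nhds p)"
      using eventually_patch[OF p] by eventually_elim (rule xi_local[symmetric])
    then show ?thesis
      by (rule vector_field_near_cong[rotated])
        (intro vector_field_nearI[OF vector_field_sum[OF patch_open frame_field] p] smooth_near_eta_coeff)
  qed
  then show ?thesis
    unfolding vector_field_iff_near by (auto intro: vector_field_near_tangent vector_field_near_smooth)
qed

lemma xi_near: "vector_field_near (atl M) p \<xi>"
  using vector_field_nearI[OF xi_vector_field] by simp

lemma xi_tangent: "\<xi> p \<in> tspace M p"
  using vector_field_near_tangent[OF xi_near] .

lemma met_xi_frame: "p \<in> patch M i \<Longrightarrow> met M p (\<xi> p) (frm M i b p) = eta_coeff i b p"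
  by (simp add: xi_local met_sum frame_tangent basis_orthonormal[OF frame_basis] if_distrib cong: if_cong)

lemma met_xi:
  assumes v: "v \<in> tspace M p"
  shows "spinor_oneform M \<psi>1 \<psi>2 p v = met M p (\<xi> p) v"
proof -
  obtain i where p: "p \<in> patch M i" using patch_cover by blast
  have sp: "\<psi>1 p \<in> spinor_space M p" "\<psi>2 p \<in> spinor_space M p"
    using killing by (auto simp: killing_spinor_def spinor_section_def)
  show ?thesis
    unfolding met_expand[OF frame_basis[OF p] xi_tangent v] met_xi_frame[OF p]
      spinor_oneform_local[of p i v \<psi>1 \<psi>2, OF p v sp]
    by (simp add: cliff_apply inner_sum_right coords_def eta_coeff_def)
qed

text \<open>The rotation terms in the derivative of \<open>\<eta>(e\<^sub>b)\<close> cancel against the derivative of the frame.\<close>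

lemma D_xi_component:
  assumes p: "p \<in> patch M i" and v: "v \<in> tspace M p"
  shows "met M p (D \<xi> p v) (frm M i b p) = (\<Sum>a\<in>UNIV. met M p v (frm M i a p) * deta_coeff i a b p)"
proof -
  have "eventually (\<lambda>q. met M q (\<xi> q) (frm M i b q) = eta_coeff i b q) (nhds p)"
    using eventually_patch[OF p] by eventually_elim (rule met_xi_frame)
  then have "v (\<lambda>q. met M q (\<xi> q) (frm M i b q)) = v (eta_coeff i b)"
    by (rule tangent_cong[OF v])
  then show ?thesis
    using D_component[OF p v xi_near, of b] derivative_eta_coeff[OF p v, of b]
    by (simp add: met_xi_frame[OF p] coords_def)
qed

lemma D_xi_skew:
  assumes v: "v \<in> tspace M p" and w: "w \<in> tspace M p"
  shows "met M p (D \<xi> p v) w = - met M p (D \<xi> p w) v"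
proof -
  obtain i where p: "p \<in> patch M i" using patch_cover by blast
  have *: "met M p (D \<xi> p v) w = (\<Sum>b\<in>UNIV. \<Sum>a\<in>UNIV. met M p w (frm M i b p) *
      (met M p v (frm M i a p) * deta_coeff i a b p))"
    if v: "v \<in> tspace M p" and w: "w \<in> tspace M p" for v w
    unfolding met_expand[OF frame_basis[OF p] D_tangent[OF xi_near v] w] D_xi_component[OF p v]
    by (simp add: sum_distrib_left)
  have "met M p (D \<xi> p v) w = (\<Sum>a\<in>UNIV. \<Sum>b\<in>UNIV. met M p w (frm M i b p) *
      (met M p v (frm M i a p) * deta_coeff i a b p))"
    unfolding *[OF v w] by (rule sum.swap)
  also have "\<dots> = - met M p (D \<xi> p w) v"
    unfolding *[OF w v] by (subst deta_coeff_skew) (simp add: sum_negf algebra_simps)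
  finally show ?thesis .
qed

text \<open>It suffices to compare products with the frame vectors \<open>e\<^sub>b\<close>. Differentiating
  \<open>g(\<nabla>\<^sub>Y \<xi>, e\<^sub>b) = \<Sum>\<^sub>a Y\<^sub>a (\<nabla>\<^sub>a \<eta>)(e\<^sub>b)\<close> produces three kinds of connection coefficients, which cancel among themselves
  and against the derivative of \<open>e\<^sub>b\<close>; the rest is the normalised double commutator.\<close>

lemma D_D_xi:
  assumes Y: "vector_field_near (atl M) p Y" and v: "v \<in> tspace M p"
  shows "D (\<lambda>q. D \<xi> q (Y q)) p v f - D \<xi> p (D Y p v) f
    = met M p (\<xi> p) (Y p) * v f - met M p v (Y p) * \<xi> p f"
proof -
  obtain i where p: "p \<in> patch M i" using patch_cover by blast
  let ?Z = "\<lambda>q. D \<xi> q (Y q)"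
  let ?e = "\<lambda>a. frm M i a p" and ?\<omega> = "conn_coeff i p v"
  let ?y = "\<lambda>a q. met M q (Y q) (frm M i a q)"
  let ?\<beta> = "\<lambda>a b. deta_coeff i a b p"
  have Z: "vector_field_near (atl M) p ?Z"
    by (rule D_vector_field_near[OF Y xi_near])
  note Yt = vector_field_near_tangent[OF Y]
  note DYt = D_tangent[OF Y v]
  have sm: "smooth_near (atl M) p (?y a)" for a
    by (rule smooth_near_met[OF Y frame_near[OF p]])
  have vy: "v (?y a) = met M p (D Y p v) (?e a) + (\<Sum>c\<in>UNIV. ?\<omega> a c * ?y c p)" for a
    using D_component[OF p v Y, of a] by simp
  have comp: "met M p (D ?Z p v) (?e b) - met M p (D \<xi> p (D Y p v)) (?e b)
      = met M p (\<xi> p) (Y p) * met M p v (?e b) - met M p v (Y p) * met M p (\<xi> p) (?e b)" for b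
  proof -
    have "eventually (\<lambda>q. met M q (?Z q) (frm M i b q) = (\<Sum>a\<in>UNIV. ?y a q * deta_coeff i a b q)) (nhds p)"
      using eventually_patch[OF p] vector_field_near_eventually_tangent[OF Y]
      by eventually_elim (rule D_xi_component)
    then have "v (\<lambda>q. met M q (?Z q) (frm M i b q)) = v (\<lambda>q. \<Sum>a\<in>UNIV. ?y a q * deta_coeff i a b q)"
      by (rule tangent_cong[OF v])
    also have "\<dots> = (\<Sum>a\<in>UNIV. v (\<lambda>q. ?y a q * deta_coeff i a b q))"
      by (rule tangent_sum[OF v]) (intro smooth_near_mult sm smooth_near_deta_coeff p)
    also have "\<dots> = (\<Sum>a\<in>UNIV. v (?y a) * ?\<beta> a b + ?y a p * v (deta_coeff i a b))"
      by (simp only: tangent_mult[OF v sm smooth_near_deta_coeff[OF p]])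
    also have "\<dots> = (\<Sum>a\<in>UNIV. met M p (D Y p v) (?e a) * ?\<beta> a b)
        + ((\<Sum>a\<in>UNIV. \<Sum>c\<in>UNIV. ?\<omega> a c * ?y c p * ?\<beta> a b)
          + (\<Sum>a\<in>UNIV. \<Sum>c\<in>UNIV. ?y a p * ?\<omega> a c * ?\<beta> c b))
        + (\<Sum>a\<in>UNIV. \<Sum>c\<in>UNIV. ?y a p * ?\<omega> b c * ?\<beta> a c)
        + (\<Sum>a\<in>UNIV. ?y a p * eta_coeff i a p) * coords i p v $ b
        - (\<Sum>a\<in>UNIV. ?y a p * coords i p v $ a) * eta_coeff i b p"
      unfolding vy derivative_deta_coeff[OF p v]
      by (simp add: sum.distrib sum_subtractf sum_distrib_left sum_distrib_right algebra_simps)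
    \<comment> \<open>The coefficients from differentiating \<open>Y\<^sub>a\<close> and those from the first index of \<open>\<beta>\<close> cancel, because
      \<open>\<omega>\<close> is skew.\<close>
    also have "(\<Sum>a\<in>UNIV. \<Sum>c\<in>UNIV. ?y a p * ?\<omega> a c * ?\<beta> c b)
        = (\<Sum>c\<in>UNIV. \<Sum>a\<in>UNIV. ?y a p * ?\<omega> a c * ?\<beta> c b)"
      by (rule sum.swap)
    also have "\<dots> = - (\<Sum>a\<in>UNIV. \<Sum>c\<in>UNIV. ?\<omega> a c * ?y c p * ?\<beta> a b)"
      by (subst conn_coeff_skew[OF p v]) (simp add: sum_negf algebra_simps)
    also have "(\<Sum>a\<in>UNIV. met M p (D Y p v) (?e a) * ?\<beta> a b) = met M p (D \<xi> p (D Y p v)) (?e b)"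
      by (rule D_xi_component[OF p DYt, symmetric])
    also have "(\<Sum>a\<in>UNIV. ?y a p * eta_coeff i a p) = met M p (\<xi> p) (Y p)"
      using met_expand[OF frame_basis[OF p] xi_tangent Yt] by (simp add: met_xi_frame[OF p])
    also have "(\<Sum>a\<in>UNIV. ?y a p * coords i p v $ a) = met M p v (Y p)"
      using met_expand[OF frame_basis[OF p] v Yt] by (simp add: coords_def)
    also have "(\<Sum>a\<in>UNIV. \<Sum>c\<in>UNIV. ?y a p * ?\<omega> b c * ?\<beta> a c)
        = (\<Sum>c\<in>UNIV. ?\<omega> b c * met M p (?Z p) (?e c))"
      unfolding D_xi_component[OF p Yt] by (subst sum.swap) (simp add: sum_distrib_left algebra_simps)
    finally show ?thesis
      using D_component[OF p v Z, of b] by (simp add: met_xi_frame[OF p] coords_def)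
  qed
  have "(\<lambda>f. D ?Z p v f - D \<xi> p (D Y p v) f)
      = (\<lambda>f. met M p (\<xi> p) (Y p) * v f + - met M p v (Y p) * \<xi> p f)"
  proof (rule basis_eqI[OF frame_basis[OF p]])
    show "(\<lambda>f. D ?Z p v f - D \<xi> p (D Y p v) f) \<in> tspace M p"
      by (intro tangent_space_diff D_tangent Z v xi_near Y)
    show "(\<lambda>f. met M p (\<xi> p) (Y p) * v f + - met M p v (Y p) * \<xi> p f) \<in> tspace M p"
      by (intro tangent_space_combine v xi_tangent)
    show "met M p (\<lambda>f. D ?Z p v f - D \<xi> p (D Y p v) f) (?e b)
        = met M p (\<lambda>f. met M p (\<xi> p) (Y p) * v f + - met M p v (Y p) * \<xi> p f) (?e b)" for b
      unfolding met_diff[OF D_tangent[OF Z v] D_tangent[OF xi_near DYt] frame_tangent[OF p]]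
        met_combine[OF v xi_tangent frame_tangent[OF p]] using comp[of b] by simp
  qed
  then show ?thesis
    by (simp add: fun_eq_iff)
qed

lemma spinor_endo_eq:
  assumes v: "v \<in> tspace M p"
  shows "spinor_endo M \<psi>1 \<psi>2 p v = (\<lambda>f. - D \<xi> p v f)"
proof -
  have "sharp M p (\<lambda>w. ext_deriv (atl M) (spinor_oneform M \<psi>1 \<psi>2) p v w) = (\<lambda>f. 2 * D \<xi> p v f)"
    using D_tangent[OF xi_near v]
    by (intro sharp_eqI) (auto simp: tangent_space_scale met_scale
        intro!: ext_deriv_dual[OF xi_vector_field D_xi_skew met_xi tangent_vector_extends v, symmetric])
  then show ?thesis
    by (simp add: spinor_endo_def)
qed

end

section \<open>The Sasakian structure\<close>

theorem theorem3p8: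
  fixes M :: "('m::{t2_space, second_countable_topology}, 'n::finite, 's::finite, 'i) spin_riem"
    and D :: "'m conn"
    and \<psi>1 \<psi>2 :: "('m, 's, 'i) spinor_field"
    and c :: complex
    and l :: "'m \<Rightarrow> real"
  assumes "riemannian_spin_manifold M"
    and "levi_civita M D"
    and "c \<in> {1/2, -1/2}"
    and "killing_spinor M D c \<psi>1"
    and "killing_spinor M D c \<psi>2"
    and "l = spinor_length M \<psi>1 \<psi>2"
    and "locally_constant l"
    and "\<forall>p. l p \<noteq> 0"
  shows "sasakian_structure M D
    (\<lambda>p f. (1 / l p) * spinor_vfield M \<psi>1 \<psi>2 p f)
    (\<lambda>p v. (1 / l p) * spinor_oneform M \<psi>1 \<psi>2 p v)
    (\<lambda>p v f. (1 / l p) * spinor_endo M \<psi>1 \<psi>2 p v f)"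
proof -
  have "c = of_real (1/2) \<or> c = of_real (-1/2)"
    using assms(3) by auto
  then obtain r :: real where r: "c = of_real r" and r_sq: "r * r = 1/4"
    by fastforce
  interpret killing_pair M D \<psi>1 \<psi>2 r
    using assms(1,2,4,5) r r_sq
    by unfold_locales (auto simp: riemannian_spin_manifold_def)
  show ?thesis
  proof (rule sasakian_structure_rescale[OF xi_vector_field D_xi_skew D_D_xi met_xi spinor_endo_eq])
    show "eventually (\<lambda>q. 1 / l q = 1 / l p) (nhds p)" for p
      using assms(7) unfolding locally_constant_def constant_on_def eventually_nhds by metis
    show "1 / l p * (1 / l p) * met M p (\<xi> p) (\<xi> p) = 1" for p
    proof -
      have l: "l p = sqrt (met M p (\<xi> p) (\<xi> p))"
        using assms(6) by (simp add: spinor_length_def)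
      have "met M p (\<xi> p) (\<xi> p) \<ge> 0"
        using met_pos[OF xi_tangent] met_zero[OF xi_tangent] by (metis less_eq_real_def)
      then have "l p * l p = met M p (\<xi> p) (\<xi> p)" by (simp add: l)
      then show ?thesis
        unfolding \<open>l p * l p = met M p (\<xi> p) (\<xi> p)\<close>[symmetric] using assms(8) by simp
    qed
  qed
qed

end
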